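(* Assume that: (i) $x\in\mathbb{X}\mapsto\bm{\mu}_x\in\mathcal{P}(\mathbb{N}^d)^d$ is continuous; (ii) $0\le \mu_x^{(i)}(\bm{0})+\sum_{j=1}^d\mu_x^{(i)}(\bm{e}_j)<1$ for all $x\in\mathbb{X}$ and $i\in\{1,\dots,d\}$; (iii) there exist constants $0<C\le D<+\infty$ such that, for all $x\in\mathbb{X}$, $C\le\min_{i,j}m_{ij}(x)\le\max_{i,j}m_{ij}(x)\le D$ and $\max_{i,j,k}\frac{\partial^2\varphi_k}{\partial s_i\partial s_j}(x,\bm{1})\le D$. Let $\nu$ be a $T$-invariant ergodic Borel probability measure on $\mathbb{X}$, and let $$\pi_\nu=\lim_{n\to\infty}\frac1n\,\mathbb{E}_\nu\big[\ln\|M(T^{n-1}\cdot)\cdots M(\cdot)\|\big].$$ Then $\nu(N)=0$ if and only if $\pi_\nu>0$.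
   Context: Setting. $\mathbb{N}=\{0,1,2,\dots\}$; $d\ge1$ is a fixed integer (the number of types); $\mathbb{X}$ is a compact metric space with its Borel $\sigma$-algebra and $T:\mathbb{X}\to\mathbb{X}$ is continuous. $\mathcal{P}(\mathbb{N}^d)$ is the set of probability measures on $\mathbb{N}^d$ with the topology of weak convergence (equivalently, of the $\ell^1$ distance). To each $x\in\mathbb{X}$ is associated $\bm{\mu}_x=(\mu_x^{(1)},\dots,\mu_x^{(d)})\in\mathcal{P}(\mathbb{N}^d)^d$. $\bm{e}_i$ is the $i$-th canonical basis vector, $\bm{0}=(0,\dots,0)$, $\bm{1}=(1,\dots,1)$; equalities and inequalities between vectors are componentwise. Process. For $x\in\mathbb{X}$, the multi-type Galton-Watson process in dynamical environments is the sequence $(\bm{Z}_n(x))_{n\in\mathbb{N}}$ in $\mathbb{N}^d$ with deterministic $\bm{Z}_0\in\mathbb{N}^d$ and, for each type $j$, $Z_{n+1}^{(j)}=\sum_{i=1}^d\sum_{k=1}^{Z_n^{(i)}}Y_{n,k}^{(i,j)}$, where the random vectors $\bm{Y}_{n,k}^{(i)}=(Y_{n,k}^{(i,1)},\dots,Y_{n,k}^{(i,d)})$ are independent and $\bm{Y}_{n,k}^{(i)}$ has law $\mu_{T^nx}^{(i)}$. Generating function. For $\bm{s}\in[0,1]^d$ and $\bm{k}\in\mathbb{N}^d$ write $\bm{s}^{\bm{k}}=\prod_j s_j^{k_j}$ (with $0^0=1$), and $\varphi_i(x,\bm{s})=\sum_{\bm{k}\in\mathbb{N}^d}\mu_x^{(i)}(\bm{k})\bm{s}^{\bm{k}}$.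 Derivatives at $\bm{1}$ are one-sided, i.e. they are the corresponding factorial moments. Mean matrix. $M(x)=(m_{ij}(x))_{1\le i,j\le d}$ with $m_{ij}(x)=\frac{\partial\varphi_j}{\partial s_i}(x,\bm{1})$, the expected number of offspring of type $i$ of an individual of type $j$ in environment $x$. The matrix norm is $\|A\|=\max_i\sum_j|a_{ij}|$. Extinction. $q_i(x)=\mathbb{P}\big(\bigcup_{n\ge0}\{\bm{Z}_n(x)=\bm{0}\}\mid\bm{Z}_0=\bm{e}_i\big)$, $\bm{q}=(q_1,\dots,q_d)$. The set of bad environments is $N=\{x\in\mathbb{X}:\bm{q}(x)=\bm{1}\}$. Under the hypotheses the limit defining $\pi_\nu$ exists and is finite. $\mathbb{E}_\nu$ denotes integration over $x$ with respect to $\nu$. *)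

theory Defs
  imports "HOL-Probability.Probability"
begin

text \<open>Probability measures on \<open>\<nat>\<^sup>d\<close> are elements of \<^typ>\<open>(nat^'d) pmf\<close>. Their topology is the
  topology of weak convergence, i.e. the initial topology for the maps
  \<open>p \<mapsto> \<integral> f dp\<close> with \<open>f\<close> bounded and continuous; \<open>\<nat>\<^sup>d\<close> being discrete, continuity of \<open>f\<close> is
  automatic.\<close>

definition weak_topology :: "'b pmf topology" where
  "weak_topology = topology_generated_by
     {{p. measure_pmf.expectation p f \<in> U} | (f :: 'b \<Rightarrow> real) U. bounded (range f) \<and> open U}"

text \<open>The process is realised on the canonical space: under \<open>offspring_measure T \<mu> x\<close> the
  coordinate \<open>\<omega> (n, k, i)\<close> is the offspring vector of the \<open>k\<close>-th individual of type \<open>i\<close> in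
  generation \<open>n\<close>; coordinates are independent with law \<open>\<mu> (T\<^sup>n x) i\<close>. (The coordinates with
  \<open>k = 0\<close> are not used.)\<close>

definition offspring_measure ::
    "('a \<Rightarrow> 'a) \<Rightarrow> ('a \<Rightarrow> 'd::finite \<Rightarrow> (nat^'d) pmf) \<Rightarrow> 'a \<Rightarrow> (nat \<times> nat \<times> 'd \<Rightarrow> nat^'d) measure" where
  "offspring_measure T \<mu> x = PiM UNIV (\<lambda>(n, k, i). measure_pmf (\<mu> ((T ^^ n) x) i))"

primrec gw_process ::
    "(nat \<times> nat \<times> 'd::finite \<Rightarrow> nat^'d) \<Rightarrow> nat^'d \<Rightarrow> nat \<Rightarrow> nat^'d" where
  "gw_process \<omega> z 0 = z"
| "gw_process \<omega> z (Suc n) =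
     (\<chi> j. \<Sum>i\<in>UNIV. \<Sum>k=1..gw_process \<omega> z n $ i. \<omega> (n, k, i) $ j)"

definition extinction_prob ::
    "('a \<Rightarrow> 'a) \<Rightarrow> ('a \<Rightarrow> 'd::finite \<Rightarrow> (nat^'d) pmf) \<Rightarrow> 'a \<Rightarrow> real^'d" where
  "extinction_prob T \<mu> x =
     (\<chi> i. \<P>(\<omega> in offspring_measure T \<mu> x. \<exists>n. gw_process \<omega> (axis i 1) n = 0))"

definition bad_environments ::
    "('a \<Rightarrow> 'a) \<Rightarrow> ('a \<Rightarrow> 'd::finite \<Rightarrow> (nat^'d) pmf) \<Rightarrow> 'a set" where
  "bad_environments T \<mu> = {x. extinction_prob T \<mu> x = 1}"

definition gen_fun ::
    "('a \<Rightarrow> 'd::finite \<Rightarrow> (nat^'d) pmf) \<Rightarrow> 'd \<Rightarrow> 'a \<Rightarrow> real^'d \<Rightarrow> real" where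
  "gen_fun \<mu> i x s = (\<Sum>\<^sub>\<infinity>k. pmf (\<mu> x i) k * (\<Prod>j\<in>UNIV. (s $ j) ^ (k $ j)))"

text \<open>One-sided (left) partial derivatives. As \<^const>\<open>vector_derivative\<close> is total, existence of a
  (finite) derivative has to be stated separately; for the generating functions at \<open>1\<close> it is
  equivalent to finiteness of the corresponding factorial moment.\<close>

definition has_left_partial :: "'d::finite \<Rightarrow> (real^'d \<Rightarrow> real) \<Rightarrow> real^'d \<Rightarrow> bool" where
  "has_left_partial i f s \<longleftrightarrow>
     (\<lambda>t. f (\<chi> l. if l = i then t else s $ l)) differentiable (at_left (s $ i))"

definition left_partial :: "'d::finite \<Rightarrow> (real^'d \<Rightarrow> real) \<Rightarrow> real^'d \<Rightarrow> real" where
  "left_partial i f s =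
     vector_derivative (\<lambda>t. f (\<chi> l. if l = i then t else s $ l)) (at_left (s $ i))"

definition mean_matrix ::
    "('a \<Rightarrow> 'd::finite \<Rightarrow> (nat^'d) pmf) \<Rightarrow> 'a \<Rightarrow> real^'d^'d" where
  "mean_matrix \<mu> x = (\<chi> i j. left_partial i (gen_fun \<mu> j x) 1)"

text \<open>The maximal row sum norm; not the library's \<^const>\<open>norm\<close>, which is Euclidean.\<close>

definition row_sum_norm :: "real^'d^'d::finite \<Rightarrow> real" where
  "row_sum_norm A = Max (range (\<lambda>i. \<Sum>j\<in>UNIV. \<bar>A $ i $ j\<bar>))"

primrec mean_cocycle ::
    "('a \<Rightarrow> 'a) \<Rightarrow> ('a \<Rightarrow> 'd::finite \<Rightarrow> (nat^'d) pmf) \<Rightarrow> nat \<Rightarrow> 'a \<Rightarrow> real^'d^'d" where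
  "mean_cocycle T \<mu> 0 x = mat 1"
| "mean_cocycle T \<mu> (Suc n) x = mean_matrix \<mu> ((T ^^ n) x) ** mean_cocycle T \<mu> n x"

definition growth_rate ::
    "('a \<Rightarrow> 'a) \<Rightarrow> ('a \<Rightarrow> 'd::finite \<Rightarrow> (nat^'d) pmf) \<Rightarrow> 'a measure \<Rightarrow> real" where
  "growth_rate T \<mu> \<nu> =
     lim (\<lambda>n. 1 / real n * (\<integral>x. ln (row_sum_norm (mean_cocycle T \<mu> n x)) \<partial>\<nu>))"

definition invariant_ergodic :: "('a::topological_space \<Rightarrow> 'a) \<Rightarrow> 'a measure \<Rightarrow> bool" where
  "invariant_ergodic T \<nu> \<longleftrightarrow>
     prob_space \<nu> \<and> sets \<nu> = sets borel \<and>
     T \<in> measurable \<nu> \<nu> \<and> distr \<nu> \<nu> T = \<nu> \<and>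
     (\<forall>A\<in>sets \<nu>. T -` A = A \<longrightarrow> measure \<nu> A = 0 \<or> measure \<nu> A = 1)"

end

theory Submission
  imports Defs
begin

text \<open>Write \<open>p x = 1 - q x\<close> for the vector of survival probabilities and \<open>M x\<close> for the mean matrix.
Conditioning on the first generation gives \<open>p x = L\<^sub>x (p (T x))\<close>, where the \<open>i\<close>-th component of
\<open>L\<^sub>x r\<close> is the probability that an individual of type \<open>i\<close> has at least one successful child when
children of type \<open>j\<close> succeed independently with probability \<open>r\<^sub>j\<close>. By the union bound
\<open>L\<^sub>x r \<le> r v* M x\<close> (row vectors act on the left), and \<open>r v* M x\<close> is the linearisation of \<open>L\<^sub>x\<close> at
\<open>0\<close>. The whole proof compares the nonlinear iteration with the product \<open>M\<^sub>n\<close> of the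
mean matrices, takes logarithms, and integrates against the invariant measure.

If survival is possible in almost every environment, then all components of \<open>p\<close> are positive and, because with
positive probability an individual has at least two children, the union bound is strict: with
\<open>\<theta> x = min\<^sub>i (p (T x) v* M x)\<^sub>i / p\<^sub>i x > 1\<close>, iterating \<open>\<theta> x p x \<le> p (T x) v* M x\<close> gives
\<open>\<Sum>\<^sub>k\<^sub><\<^sub>n ln \<theta> (T\<^sup>k x) + g x - g (T\<^sup>n x) \<le> ln \<parallel>M\<^sub>n x\<parallel>\<close> with \<open>g = ln (\<Sum>\<^sub>i p\<^sub>i)\<close>
(\<open>sum_ln_expansion_le\<close>). The difference \<open>g \<circ> T - g\<close> is bounded, hence has integral \<open>0\<close> even when \<open>g\<close>
is not integrable (\<open>integral_coboundary\<close>). So the growth rate is at least \<open>\<integral> ln \<theta> > 0\<close>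
(\<open>growth_rate_pos_if_survival\<close>). The strictness excludes the critical growth rate \<open>0\<close>.

Conversely, extinction from \<open>x\<close> and from \<open>T x\<close> are equivalent, so by ergodicity the bad
environments have measure \<open>0\<close> or \<open>1\<close>. If the measure is \<open>1\<close>, the probabilities \<open>p\<^sub>n\<close> of surviving \<open>n\<close>
generations tend to \<open>0\<close> almost surely, and close to \<open>0\<close> the map \<open>L\<^sub>x\<close> is asymptotic to its
linearisation (\<open>survive_prob_asymp\<close>). Replacing \<open>M\<close> by \<open>L\<close> one factor at a time costs a multiplicative
loss at each step, so that \<open>ln \<parallel>M\<^sub>n x\<parallel> \<le> ln d + \<Sum>\<^sub>k\<^sub><\<^sub>n ln (loss\<^sub>n\<^sub>-\<^sub>1\<^sub>-\<^sub>k (T\<^sup>k x))\<close>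
(\<open>ln_cocycle_norm_le_sum_loss\<close>), where the losses are bounded and tend to \<open>1\<close> almost surely. After
integration the right side is a constant plus a sum of terms tending to \<open>0\<close>, and the growth rate is at
most \<open>0\<close> (\<open>growth_rate_nonpos_if_extinction\<close>).

Three supporting facts connect this with the definitions: the left derivatives of the generating
functions are the first moments (\<open>mean_matrix_eq\<close>), the generating function of the process is the
iterate of the offspring generating functions (\<open>expectation_vpow_gw_process\<close>), and the limit defining
the growth rate exists by subadditivity (\<open>growth_rate_limit\<close>).\<close>

section \<open>Monomials and the union bound\<close>

text \<open>The unit vectors \<open>axis j 1\<close> over \<open>nat\<close> occur throughout; without this the simplifier would turn
them into \<open>axis j (Suc 0)\<close>, to which facts about \<open>axis j 1\<close> do not apply.\<close>

declare One_nat_def [simp del]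

definition vpow :: "real^'d::finite \<Rightarrow> nat^'d \<Rightarrow> real" where
  "vpow s k = (\<Prod>j\<in>UNIV. (s $ j) ^ (k $ j))"

definition unit_cube :: "(real^'d::finite) set" where
  "unit_cube = {p. \<forall>j. 0 \<le> p $ j \<and> p $ j \<le> 1}"

lemma unit_cubeD: "p \<in> unit_cube \<Longrightarrow> 0 \<le> p $ j" "p \<in> unit_cube \<Longrightarrow> p $ j \<le> 1"
  by (auto simp: unit_cube_def)

lemma one_minus_unit_cube: "p \<in> unit_cube \<Longrightarrow> 1 - p \<in> unit_cube"
  by (auto simp: unit_cube_def)

lemma zero_one_unit_cube: "0 \<in> unit_cube" "1 \<in> unit_cube"
  by (auto simp: unit_cube_def)

lemma vpow_0 [simp]: "vpow s 0 = 1"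
  by (simp add: vpow_def)

lemma vpow_one [simp]: "vpow 1 k = 1"
  by (simp add: vpow_def)

lemma vpow_axis [simp]: "vpow s (axis j 1) = s $ j"
proof -
  have "(\<Prod>l\<in>UNIV. (s $ l) ^ (axis j 1 $ l)) = (\<Prod>l\<in>UNIV. if l = j then s $ l else 1)"
    by (intro prod.cong) (auto simp: axis_def)
  then show ?thesis by (simp add: vpow_def)
qed

lemma vpow_add: "vpow s (k + l) = vpow s k * vpow s l"
  by (simp add: vpow_def power_add prod.distrib)

lemma vpow_nonneg: "s \<in> unit_cube \<Longrightarrow> 0 \<le> vpow s k"
  by (auto simp: vpow_def unit_cube_def intro!: prod_nonneg)

lemma vpow_le_1: "s \<in> unit_cube \<Longrightarrow> vpow s k \<le> 1"
  unfolding vpow_def by (intro prod_le_1) (auto simp: unit_cube_def power_le_one)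

lemma vpow_abs_le_1: "s \<in> unit_cube \<Longrightarrow> \<bar>vpow s k\<bar> \<le> 1"
  using vpow_nonneg[of s k] vpow_le_1[of s k] by simp

lemma vpow_le_component:
  assumes "s \<in> unit_cube" "k $ j \<noteq> 0"
  shows "vpow s k \<le> s $ j"
proof -
  have "(\<chi> l. if l = j then k $ j - 1 else k $ l) + axis j 1 = k"
    using assms(2) by (auto simp: vec_eq_iff axis_def)
  then have "vpow s k = vpow s (\<chi> l. if l = j then k $ j - 1 else k $ l) * vpow s (axis j 1)"
    using vpow_add[of s _ "axis j 1"] by metis
  also have "vpow s (axis j 1) = s $ j" by simp
  also have "vpow s (\<chi> l. if l = j then k $ j - 1 else k $ l) * s $ j \<le> 1 * s $ j"
    using assms(1) by (intro mult_right_mono vpow_le_1) (auto simp: unit_cube_def)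
  finally show ?thesis by simp
qed

lemma multi_index_cases:
  fixes k :: "nat^'d::finite"
  obtains "k = 0" | l j where "k = l + axis j 1" "sum (\<lambda>i. l $ i) UNIV < sum (\<lambda>i. k $ i) UNIV"
proof (cases "k = 0")
  case False
  then obtain j where j: "k $ j \<noteq> 0" by (auto simp: vec_eq_iff)
  define l where "l = (\<chi> i. if i = j then k $ j - 1 else k $ i)"
  have l: "k = l + axis j 1"
    using j by (auto simp: l_def vec_eq_iff axis_def)
  have "sum (\<lambda>i. l $ i) UNIV < sum (\<lambda>i. k $ i) UNIV"
    using j by (intro sum_strict_mono_ex1) (auto simp: l_def intro!: exI[of _ j])
  with l that show ?thesis by blast
qed (use that in blast)

text \<open>Building a population one individual at a time turns bounds on products over types and
individuals into a one-step computation.\<close>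

lemma multi_index_induct:
  fixes k :: "nat^'d::finite"
  assumes "P 0" "\<And>l j. P l \<Longrightarrow> P (l + axis j 1)"
  shows "P k"
proof (induction "sum (\<lambda>i. k $ i) UNIV" arbitrary: k rule: less_induct)
  case less
  show ?case
    by (cases k rule: multi_index_cases) (use less assms in auto)
qed

text \<open>When a child of type \<open>j\<close> is successful with probability \<open>p\<^sub>j\<close>, this is the expected number of
successful children in the litter \<open>k\<close>, while \<open>1 - vpow (1 - p) k\<close> is the probability that there is at
least one.\<close>

definition weighted_size :: "real^'d::finite \<Rightarrow> nat^'d \<Rightarrow> real" where
  "weighted_size p k = (\<Sum>j\<in>UNIV. real (k $ j) * p $ j)"

lemma weighted_size_0 [simp]: "weighted_size p 0 = 0"
  by (simp add: weighted_size_def)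

lemma weighted_size_step [simp]: "weighted_size p (k + axis j 1) = weighted_size p k + p $ j"
proof -
  have "(\<Sum>l\<in>UNIV. real (axis j 1 $ l) * p $ l) = (\<Sum>l\<in>UNIV. if l = j then p $ l else 0)"
    by (intro sum.cong) (auto simp: axis_def)
  then show ?thesis
    by (simp add: weighted_size_def algebra_simps sum.distrib)
qed

lemma weighted_size_nonneg: "p \<in> unit_cube \<Longrightarrow> 0 \<le> weighted_size p k"
  by (auto simp: weighted_size_def unit_cube_def intro!: sum_nonneg)

lemma union_bound:
  assumes "p \<in> unit_cube"
  shows "1 - vpow (1 - p) k \<le> weighted_size p k"
proof (induction k rule: multi_index_induct)
  case (2 l j)
  have "(1 - vpow (1 - p) (l + axis j 1)) = 1 - vpow (1 - p) l + p $ j * vpow (1 - p) l"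
    by (simp add: vpow_add algebra_simps)
  also have "p $ j * vpow (1 - p) l \<le> p $ j * 1"
    using assms by (intro mult_left_mono vpow_le_1 one_minus_unit_cube) (auto simp: unit_cube_def)
  finally show ?case using 2 by simp
qed simp

text \<open>Adding an individual to a non-empty litter \<open>l\<close> raises the left side by
\<open>p\<^sub>j vpow (1 - p) l < p\<^sub>j\<close>: with two or more individuals the events of success overlap.\<close>

lemma union_bound_strict:
  fixes k :: "nat^'d::finite"
  assumes p: "p \<in> unit_cube" "\<And>j. 0 < p $ j" and k: "k \<noteq> 0" "\<And>j. k \<noteq> axis j 1"
  shows "1 - vpow (1 - p) k < weighted_size p k"
proof -
  obtain l j where l: "k = l + axis j 1"
    using k(1) by (cases k rule: multi_index_cases) auto
  with k(2)[of j] have "l \<noteq> 0" by auto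
  then obtain i where i: "l $ i \<noteq> 0" by (auto simp: vec_eq_iff)
  have "vpow (1 - p) l \<le> 1 - p $ i"
    using vpow_le_component[of "1 - p" l i] i p(1) by (simp add: one_minus_unit_cube)
  then have "p $ j * vpow (1 - p) l < p $ j * 1"
    using p(2)[of i] p(2)[of j] by (intro mult_strict_left_mono) auto
  moreover have "1 - vpow (1 - p) k = 1 - vpow (1 - p) l + p $ j * vpow (1 - p) l"
    by (simp add: l vpow_add algebra_simps)
  ultimately show ?thesis
    using union_bound[OF p(1), of l] by (simp add: l)
qed

lemma vpow_le_exp:
  assumes "p \<in> unit_cube"
  shows "vpow (1 - p) k \<le> exp (- weighted_size p k)"
proof (induction k rule: multi_index_induct)
  case (2 l j)
  have "vpow (1 - p) (l + axis j 1) = vpow (1 - p) l * (1 - p $ j)"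
    by (simp add: vpow_add)
  also have "\<dots> \<le> exp (- weighted_size p l) * exp (- (p $ j))"
    using assms exp_ge_add_one_self[of "- (p $ j)"]
    by (intro mult_mono 2) (auto simp: unit_cube_def)
  finally show ?case by (simp add: exp_add[symmetric])
qed simp

text \<open>Only the order of the quadratic error matters; it comes from \<open>vpow (1 - p) k \<le> e\<^sup>-\<^sup>u \<le> 1 / (1 + u)\<close>
with \<open>u\<close> the weighted size.\<close>

lemma inclusion_exclusion_bound:
  assumes "p \<in> unit_cube"
  shows "weighted_size p k - (weighted_size p k)\<^sup>2 \<le> 1 - vpow (1 - p) k"
proof -
  define u where "u = weighted_size p k"
  have u: "0 \<le> u" using assms by (simp add: u_def weighted_size_nonneg)
  have "exp (- u) = 1 / exp u" by (simp add: exp_minus inverse_eq_divide)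
  also have "\<dots> \<le> 1 / (1 + u)"
    using u exp_ge_add_one_self[of u] by (intro divide_left_mono) auto
  also have "\<dots> \<le> 1 - u + u\<^sup>2"
  proof -
    have "1 \<le> (1 - u + u\<^sup>2) * (1 + u)"
      using u by (simp add: algebra_simps power2_eq_square)
    then show ?thesis using u by (simp add: pos_divide_le_eq)
  qed
  finally show ?thesis using vpow_le_exp[OF assms, of k] by (simp add: u_def)
qed

section \<open>Survival under one offspring law\<close>

definition survive_prob :: "(nat^'d) pmf \<Rightarrow> real^'d::finite \<Rightarrow> real" where
  "survive_prob P p = measure_pmf.expectation P (\<lambda>k. 1 - vpow (1 - p) k)"

definition finite_mean :: "(nat^'d::finite) pmf \<Rightarrow> bool" where
  "finite_mean P \<longleftrightarrow> (\<forall>j. integrable (measure_pmf P) (\<lambda>k. real (k $ j)))"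

definition mean_offspring :: "(nat^'d::finite) pmf \<Rightarrow> 'd \<Rightarrow> real" where
  "mean_offspring P j = measure_pmf.expectation P (\<lambda>k. real (k $ j))"

lemma integrable_vpow:
  fixes P :: "(nat^'d::finite) pmf"
  assumes "s \<in> unit_cube"
  shows "integrable (measure_pmf P) (\<lambda>k. vpow s k)"
  using assms by (intro measure_pmf.integrable_const_bound[where B=1]) (auto simp: vpow_abs_le_1)

lemma integrable_survive:
  fixes P :: "(nat^'d::finite) pmf"
  assumes "p \<in> unit_cube"
  shows "integrable (measure_pmf P) (\<lambda>k. 1 - vpow (1 - p) k)"
  using assms by (intro Bochner_Integration.integrable_diff integrable_vpow one_minus_unit_cube) auto

lemma survive_prob_ge:
  fixes P :: "(nat^'d::finite) pmf"
  assumes "p \<in> unit_cube"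
  shows "measure_pmf.prob P {k. k $ j \<noteq> 0} * p $ j \<le> survive_prob P p"
proof -
  have "measure_pmf.prob P {k. k $ j \<noteq> 0} * p $ j
      = measure_pmf.expectation P (\<lambda>k. indicator {k. k $ j \<noteq> 0} k * p $ j)"
    by simp
  also have "\<dots> \<le> survive_prob P p"
    unfolding survive_prob_def
  proof (intro integral_mono integrable_survive assms)
    fix k :: "nat^'d"
    show "indicator {k. k $ j \<noteq> 0} k * p $ j \<le> 1 - vpow (1 - p) k"
      using vpow_le_component[of "1 - p" k j] vpow_le_1[of "1 - p" k] assms
      by (auto simp: one_minus_unit_cube indicator_def)
  qed (auto intro!: integrable_mult_left integrable_real_indicator simp: measure_pmf.emeasure_eq_measure)
  finally show ?thesis .
qed

lemma integrable_weighted_size: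
  assumes "finite_mean P"
  shows "integrable (measure_pmf P) (weighted_size p)"
  unfolding weighted_size_def[abs_def] using assms
  by (intro Bochner_Integration.integrable_sum integrable_mult_left) (auto simp: finite_mean_def)

lemma expectation_weighted_size:
  assumes "finite_mean P"
  shows "measure_pmf.expectation P (weighted_size p) = (\<Sum>j\<in>UNIV. mean_offspring P j * p $ j)"
  unfolding weighted_size_def[abs_def] using assms
  by (subst Bochner_Integration.integral_sum) (auto simp: finite_mean_def mean_offspring_def)

lemma survive_prob_le_mean:
  assumes "p \<in> unit_cube" "finite_mean P"
  shows "survive_prob P p \<le> (\<Sum>j\<in>UNIV. mean_offspring P j * p $ j)"
  unfolding expectation_weighted_size[OF assms(2), symmetric] survive_prob_def
  using assms by (intro integral_mono integrable_survive integrable_weighted_size union_bound)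

lemma survive_prob_less_mean:
  fixes P :: "(nat^'d::finite) pmf"
  assumes p: "p \<in> unit_cube" "\<And>j. 0 < p $ j" and P: "finite_mean P"
    and branching: "pmf P 0 + (\<Sum>j\<in>UNIV. pmf P (axis j 1)) < 1"
  shows "survive_prob P p < (\<Sum>j\<in>UNIV. mean_offspring P j * p $ j)"
proof -
  \<comment> \<open>By hypothesis some litter with at least two children has positive weight.\<close>
  define S where "S = insert 0 (range (\<lambda>j. axis j 1 :: nat^'d))"
  have inj: "inj (\<lambda>j. axis j 1 :: nat^'d)"
    by (auto simp: inj_def axis_eq_axis)
  have "measure_pmf.prob P S = (\<Sum>k\<in>S. pmf P k)"
    by (simp add: S_def measure_measure_pmf_finite)
  also have "\<dots> = pmf P 0 + (\<Sum>k\<in>range (\<lambda>j. axis j 1). pmf P k)"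
    unfolding S_def by (subst sum.insert) (auto simp: axis_eq_0_iff dest: sym)
  also have "(\<Sum>k\<in>range (\<lambda>j. axis j 1). pmf P k) = (\<Sum>j\<in>UNIV. pmf P (axis j 1))"
    by (rule sum.reindex_cong[OF inj]) auto
  finally have "measure_pmf.prob P S < 1" using branching by simp
  then have "\<not> set_pmf P \<subseteq> S"
    using measure_pmf.prob_eq_1[of S P] by (auto simp: AE_measure_pmf_iff)
  then obtain k where k: "k \<in> set_pmf P" "k \<notin> S" by blast
  define f where "f k = weighted_size p k - (1 - vpow (1 - p) k)" for k
  have f0: "0 \<le> f l" for l using union_bound[OF p(1), of l] by (simp add: f_def)
  have fk: "0 < f k"
    using union_bound_strict[OF p, of k] k(2) by (auto simp: f_def S_def)
  have int: "integrable (measure_pmf P) f"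
    unfolding f_def using p P by (intro Bochner_Integration.integrable_diff integrable_survive integrable_weighted_size)
  have "pmf P k * f k = measure_pmf.expectation P (\<lambda>l. indicator {k} l * f k)"
    by (simp add: measure_pmf_single)
  also have "\<dots> \<le> measure_pmf.expectation P f"
    using f0 fk by (intro integral_mono int integrable_mult_left integrable_real_indicator)
                   (auto simp: indicator_def measure_pmf.emeasure_eq_measure)
  finally have "0 < measure_pmf.expectation P f"
    using fk k(1) by (smt (verit) mult_pos_pos pmf_positive)
  also have "measure_pmf.expectation P f = (\<Sum>j\<in>UNIV. mean_offspring P j * p $ j) - survive_prob P p"
    unfolding f_def survive_prob_def expectation_weighted_size[OF P, symmetric]
    using p P by (intro Bochner_Integration.integral_diff integrable_survive integrable_weighted_size)
  finally show ?thesis by simp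
qed

lemma tendsto_vpow:
  assumes "\<And>j. ((\<lambda>n. s n $ j) \<longlongrightarrow> t $ j) F"
  shows "((\<lambda>n. vpow (s n) k) \<longlongrightarrow> vpow t k) F"
  unfolding vpow_def by (intro tendsto_prod tendsto_power assms)

lemma tendsto_survive_prob:
  assumes "\<And>n. p n \<in> unit_cube" "\<And>j. (\<lambda>n. p n $ j) \<longlonglongrightarrow> r $ j"
  shows "(\<lambda>n. survive_prob P (p n)) \<longlonglongrightarrow> survive_prob P r"
  unfolding survive_prob_def
proof (rule integral_dominated_convergence[where w="\<lambda>_. 1"])
  show "AE k in measure_pmf P. (\<lambda>n. 1 - vpow (1 - p n) k) \<longlonglongrightarrow> 1 - vpow (1 - r) k"
    by (intro AE_I2 tendsto_diff tendsto_const tendsto_vpow) (auto intro!: tendsto_diff assms)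
  show "AE k in measure_pmf P. norm (1 - vpow (1 - p n) k) \<le> 1" for n
    using assms(1)[of n] by (auto simp: vpow_le_1 vpow_nonneg one_minus_unit_cube)
qed auto

text \<open>The error \<open>weighted_size p k - (1 - vpow (1 - p) k)\<close>, divided by \<open>\<Sum>\<^sub>j p\<^sub>j\<close>, is at most the
number of children, which is integrable, and at most its square times \<open>\<Sum>\<^sub>j p\<^sub>j\<close>, which tends to \<open>0\<close>
for each litter. Dominated convergence gives the asymptotics from first moments.\<close>

lemma survive_prob_asymp:
  fixes P :: "(nat^'d::finite) pmf"
  assumes p: "\<And>n. p n \<in> unit_cube" "\<And>n j. 0 < p n $ j" "\<And>j. (\<lambda>n. p n $ j) \<longlonglongrightarrow> 0"
    and P: "finite_mean P" and pos: "\<And>j. 0 < mean_offspring P j"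
  shows "(\<lambda>n. survive_prob P (p n) / (\<Sum>j\<in>UNIV. mean_offspring P j * p n $ j)) \<longlonglongrightarrow> 1"
proof -
  define S where "S n = (\<Sum>j\<in>UNIV. p n $ j)" for n
  define L where "L n = (\<Sum>j\<in>UNIV. mean_offspring P j * p n $ j)" for n
  define c where "c = Min (range (mean_offspring P))"
  have c: "0 < c" "\<And>j. c \<le> mean_offspring P j"
    using pos by (auto simp: c_def)
  have S: "0 < S n" for n unfolding S_def using p(2) by (intro sum_pos) auto
  have L: "c * S n \<le> L n" for n
    unfolding S_def L_def sum_distrib_left using p(2) c(2)
    by (intro sum_mono mult_right_mono) (auto intro: less_imp_le)
  have L_pos: "0 < L n" for n using L[of n] S[of n] c(1) by (meson less_le_trans mult_pos_pos)
  have S0: "S \<longlonglongrightarrow> 0"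
    unfolding S_def[abs_def] using tendsto_sum[of UNIV "\<lambda>j n. p n $ j" "\<lambda>_. 0"] p(3) by simp
  define size where "size k = (\<Sum>j\<in>UNIV. real (k $ j))" for k :: "nat^'d"
  have size0: "0 \<le> size k" for k by (simp add: size_def sum_nonneg)
  have ws: "weighted_size (p n) k \<le> size k * S n" for n k
  proof -
    have "weighted_size (p n) k \<le> (\<Sum>j\<in>UNIV. real (k $ j) * S n)"
      unfolding weighted_size_def S_def using p(2)
      by (intro sum_mono mult_left_mono member_le_sum) (auto intro: less_imp_le)
    then show ?thesis by (simp add: size_def sum_distrib_right)
  qed
  define r where "r n k = (weighted_size (p n) k - (1 - vpow (1 - p n) k)) / S n" for n k
  have r0: "0 \<le> r n k" for n k
    using union_bound[OF p(1)[of n], of k] S[of n] by (simp add: r_def)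
  have r1: "r n k \<le> size k" for n k
  proof -
    have "r n k \<le> weighted_size (p n) k / S n"
      unfolding r_def using S[of n] vpow_le_1[of "1 - p n" k] p(1)
      by (intro divide_right_mono) (auto simp: one_minus_unit_cube less_imp_le)
    also have "\<dots> \<le> size k" using ws[of n k] S[of n] by (simp add: pos_divide_le_eq)
    finally show ?thesis .
  qed
  have r2: "r n k \<le> (size k)\<^sup>2 * S n" for n k
  proof -
    have "r n k \<le> (weighted_size (p n) k)\<^sup>2 / S n"
      unfolding r_def using S[of n] inclusion_exclusion_bound[OF p(1)[of n], of k]
      by (intro divide_right_mono) (auto simp: less_imp_le)
    also have "\<dots> \<le> (size k * S n)\<^sup>2 / S n"
      using S[of n] by (intro divide_right_mono power_mono ws weighted_size_nonneg p) (auto simp: less_imp_le)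
    also have "\<dots> = (size k)\<^sup>2 * S n" using S[of n] by (simp add: power2_eq_square)
    finally show ?thesis .
  qed
  have "(\<lambda>n. measure_pmf.expectation P (r n)) \<longlonglongrightarrow> measure_pmf.expectation P (\<lambda>_. 0)"
  proof (rule integral_dominated_convergence[where w=size])
    show "integrable (measure_pmf P) size"
      unfolding size_def using P by (intro Bochner_Integration.integrable_sum) (auto simp: finite_mean_def)
    show "AE k in measure_pmf P. (\<lambda>n. r n k) \<longlonglongrightarrow> 0"
    proof (rule AE_I2)
      fix k
      have "(\<lambda>n. (size k)\<^sup>2 * S n) \<longlonglongrightarrow> 0"
        using tendsto_mult[OF tendsto_const S0] by simp
      then show "(\<lambda>n. r n k) \<longlonglongrightarrow> 0"
        by (rule Lim_null_comparison[rotated]) (simp add: r0 r2)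
    qed
  qed (use r0 r1 in auto)
  then have R: "(\<lambda>n. measure_pmf.expectation P (r n) / c) \<longlonglongrightarrow> 0"
    using tendsto_divide[OF _ tendsto_const[of c]] c(1) by fastforce
  have "1 - measure_pmf.expectation P (r n) / c \<le> survive_prob P (p n) / L n" for n
  proof -
    have "measure_pmf.expectation P (r n) = (L n - survive_prob P (p n)) / S n"
      unfolding r_def L_def survive_prob_def expectation_weighted_size[OF P, symmetric]
      using p P by (simp add: Bochner_Integration.integral_diff integrable_survive integrable_weighted_size)
    then have E: "L n - survive_prob P (p n) = measure_pmf.expectation P (r n) * S n"
      using S[of n] by (simp add: field_simps)
    have "0 \<le> measure_pmf.expectation P (r n)" using r0 by simp
    then have "measure_pmf.expectation P (r n) * (c * S n) \<le> measure_pmf.expectation P (r n) * L n"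
      by (intro mult_left_mono L)
    with E have "L n - survive_prob P (p n) \<le> measure_pmf.expectation P (r n) / c * L n"
      using c(1) by (simp add: field_simps)
    then show ?thesis using L_pos[of n] by (simp add: field_simps)
  qed
  moreover have "survive_prob P (p n) / L n \<le> 1" for n
    using survive_prob_le_mean[OF p(1) P, of n] L_pos[of n] by (simp add: L_def)
  moreover have "(\<lambda>n. 1 - measure_pmf.expectation P (r n) / c) \<longlonglongrightarrow> 1"
    using tendsto_diff[OF tendsto_const R, of 1] by simp
  ultimately have "(\<lambda>n. survive_prob P (p n) / L n) \<longlonglongrightarrow> 1"
    using real_tendsto_sandwich[of "\<lambda>n. 1 - measure_pmf.expectation P (r n) / c"
        "\<lambda>n. survive_prob P (p n) / L n" sequentially "\<lambda>_. 1" 1] by simp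
  then show ?thesis by (simp add: L_def)
qed

section \<open>Means from left derivatives\<close>

text \<open>Outside the unit cube the sum defining the generating function may diverge.\<close>

lemma gen_fun_eq_expectation:
  assumes "s \<in> unit_cube"
  shows "gen_fun \<mu> j x s = measure_pmf.expectation (\<mu> x j) (vpow s)"
proof -
  have "(\<lambda>k. norm (pmf (\<mu> x j) k * vpow s k)) summable_on UNIV"
  proof (rule Infinite_Sum.abs_summable_on_comparison_test)
    show "(\<lambda>k. norm (pmf (\<mu> x j) k)) summable_on UNIV"
      using pmf_abs_summable[of "\<mu> x j" UNIV] by (simp only: abs_summable_equivalent)
    show "norm (pmf (\<mu> x j) k * vpow s k) \<le> norm (pmf (\<mu> x j) k)" for k
      using mult_left_mono[OF vpow_abs_le_1[OF assms], of "pmf (\<mu> x j) k" k] by (simp add: abs_mult)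
  qed
  then show ?thesis
    unfolding gen_fun_def vpow_def[symmetric] pmf_expectation_eq_infsetsum
    by (intro infsetsum_infsum[symmetric]) (simp only: abs_summable_equivalent)
qed

text \<open>With the other variables equal to \<open>1\<close>, the difference quotient at \<open>t < 1\<close> is the expectation of
\<open>\<Sum>l<k\<^sub>i. t ^ l\<close>, which increases to \<open>k\<^sub>i\<close> as \<open>t\<close> increases to \<open>1\<close>. By
monotone convergence, a finite derivative yields both integrability and the value of the mean.\<close>

lemma
  fixes \<mu> :: "'a \<Rightarrow> 'd::finite \<Rightarrow> (nat^'d) pmf"
  assumes "has_left_partial i (gen_fun \<mu> j x) 1"
  shows integrable_from_left_partial: "integrable (measure_pmf (\<mu> x j)) (\<lambda>k. real (k $ i))"
    and mean_matrix_eq: "mean_matrix \<mu> x $ i $ j = mean_offspring (\<mu> x j) i"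
proof -
  define v where "v t = ((\<chi> l. if l = i then t else 1) :: real^'d)" for t :: real
  define f where "f t = gen_fun \<mu> j x (v t)" for t
  define m where "m = mean_matrix \<mu> x $ i $ j"
  define t where "t n = 1 - inverse (real (Suc n))" for n
  have t: "0 \<le> t n" "t n < 1" for n
    by (simp_all add: t_def field_simps)
  have "incseq t"
    by (auto simp: incseq_def t_def intro!: le_imp_inverse_le)
  have "(f has_vector_derivative m) (at_left 1)"
  proof -
    have "f differentiable (at_left 1)"
      using assms by (simp add: f_def[abs_def] v_def has_left_partial_def cong: if_cong)
    moreover have "m = vector_derivative f (at_left 1)"
      by (simp add: f_def[abs_def] v_def m_def mean_matrix_def left_partial_def cong: if_cong)
    ultimately show ?thesis by (simp add: vector_derivative_works)
  qed
  then have "((\<lambda>y. (f y - f 1) / (y - 1)) \<longlongrightarrow> m) (at_left 1)"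
    by (simp add: has_field_derivative_iff flip: has_real_derivative_iff_has_vector_derivative)
  moreover have "filterlim t (at_left 1) sequentially"
  proof (rule tendsto_imp_filterlim_at_left)
    show "t \<longlonglongrightarrow> 1"
      unfolding t_def[abs_def] using tendsto_diff[OF tendsto_const LIMSEQ_inverse_real_of_nat, of 1] by simp
  qed (use t in auto)
  ultimately have lim: "(\<lambda>n. (f (t n) - f 1) / (t n - 1)) \<longlonglongrightarrow> m"
    by (rule filterlim_compose)
  have vpow_v: "vpow (v y) k = y ^ (k $ i)" for y and k :: "nat^'d"
  proof -
    have "vpow (v y) k = (\<Prod>l\<in>UNIV. if l = i then y ^ (k $ l) else 1)"
      unfolding vpow_def v_def by (intro prod.cong) auto
    then show ?thesis by simp
  qed
  have f: "f y = measure_pmf.expectation (\<mu> x j) (\<lambda>k. y ^ (k $ i))" if "0 \<le> y" "y \<le> 1" for y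
  proof -
    have "v y \<in> unit_cube" using that by (auto simp: unit_cube_def v_def)
    then show ?thesis by (simp add: f_def gen_fun_eq_expectation vpow_v[abs_def])
  qed
  have int_pow: "integrable (measure_pmf (\<mu> x j)) (\<lambda>k. y ^ (k $ i))" if "0 \<le> y" "y \<le> 1" for y :: real
    using that by (intro measure_pmf.integrable_const_bound[where B=1]) (auto simp: power_le_one)
  define g where "g n k = (\<Sum>l<k $ i. t n ^ l)" for n and k :: "nat^'d"
  have g: "g n k = (1 - t n ^ (k $ i)) / (1 - t n)" for n k
    unfolding g_def one_diff_power_eq using t(2)[of n] by simp
  have int_g: "integrable (measure_pmf (\<mu> x j)) (g n)" for n
    unfolding g using t[of n] int_pow[of "t n"] by simp
  have "(f (t n) - f 1) / (t n - 1) = measure_pmf.expectation (\<mu> x j) (g n)" for n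
  proof -
    have "measure_pmf.expectation (\<mu> x j) (g n) = (1 - f (t n)) / (1 - t n)"
      unfolding g using t[of n] int_pow[of "t n"] by (simp add: f)
    also have "1 = f 1" by (simp add: f)
    finally show ?thesis using t[of n] by (simp add: f divide_simps) (simp add: algebra_simps)
  qed
  with lim have lim: "(\<lambda>n. measure_pmf.expectation (\<mu> x j) (g n)) \<longlonglongrightarrow> m" by simp
  have *: "integrable (measure_pmf (\<mu> x j)) (\<lambda>k. real (k $ i))
    \<and> measure_pmf.expectation (\<mu> x j) (\<lambda>k. real (k $ i)) = m"
  proof (intro conjI)
    have mono: "AE k in measure_pmf (\<mu> x j). mono (\<lambda>n. g n k)"
      using \<open>incseq t\<close> t by (auto simp: mono_def g_def intro!: sum_mono power_mono)
    have "t \<longlonglongrightarrow> 1"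
      unfolding t_def[abs_def] using tendsto_diff[OF tendsto_const LIMSEQ_inverse_real_of_nat, of 1] by simp
    then have "(\<lambda>n. g n k) \<longlonglongrightarrow> (\<Sum>l<k $ i. 1 ^ l)" for k
      unfolding g_def by (intro tendsto_sum tendsto_power)
    then have ptw: "AE k in measure_pmf (\<mu> x j). (\<lambda>n. g n k) \<longlonglongrightarrow> real (k $ i)" by simp
    show "integrable (measure_pmf (\<mu> x j)) (\<lambda>k. real (k $ i))"
      by (rule integrable_monotone_convergence[OF int_g mono ptw lim]) simp
    show "measure_pmf.expectation (\<mu> x j) (\<lambda>k. real (k $ i)) = m"
      by (rule integral_monotone_convergence[OF int_g mono ptw lim]) simp
  qed
  then show "integrable (measure_pmf (\<mu> x j)) (\<lambda>k. real (k $ i))" by simp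
  show "mean_matrix \<mu> x $ i $ j = mean_offspring (\<mu> x j) i"
    using * by (simp add: m_def mean_offspring_def)
qed

section \<open>Dependence on the environment\<close>

lemma continuous_expectation:
  fixes \<mu> :: "'a::metric_space \<Rightarrow> 'd \<Rightarrow> 'b pmf" and f :: "'b \<Rightarrow> real"
  assumes "continuous_map euclidean (product_topology (\<lambda>_. weak_topology) UNIV) \<mu>"
    and "bounded (range f)"
  shows "continuous_on UNIV (\<lambda>x. measure_pmf.expectation (\<mu> x i) f)"
proof -
  have cont: "continuous_map euclidean weak_topology (\<lambda>x. \<mu> x i)"
    using assms(1) by (simp add: continuous_map_componentwise_UNIV)
  show ?thesis
  proof (rule continuous_on_open_vimage[THEN iffD2, OF open_UNIV], intro allI impI)
    fix U :: "real set" assume "open U"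
    then have "openin weak_topology {p. measure_pmf.expectation p f \<in> U}"
      unfolding weak_topology_def using assms(2) by (intro topology_generated_by_Basis) auto
    from openin_continuous_map_preimage[OF cont this]
    show "open ((\<lambda>x. measure_pmf.expectation (\<mu> x i) f) -` U \<inter> UNIV)"
      by (simp add: vimage_def)
  qed
qed

text \<open>Means and other expectations of unbounded functions need not be continuous in the environment, but
they are measurable, because the laws form a measurable kernel.\<close>

lemma measurable_kernel:
  fixes \<mu> :: "'a::metric_space \<Rightarrow> 'd \<Rightarrow> 'b pmf"
  assumes "continuous_map euclidean (product_topology (\<lambda>_. weak_topology) UNIV) \<mu>"
  shows "(\<lambda>x. measure_pmf (\<mu> x i)) \<in> measurable borel (subprob_algebra (count_space UNIV))"
proof (rule measurable_subprob_algebra)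
  fix A :: "'b set"
  have "bounded (range (indicator A :: 'b \<Rightarrow> real))"
    by (intro boundedI[where B=1]) auto
  from continuous_expectation[OF assms this]
  have "continuous_on UNIV (\<lambda>x. measure_pmf.prob (\<mu> x i) A)" by simp
  then have "(\<lambda>x. measure_pmf.prob (\<mu> x i) A) \<in> borel_measurable borel"
    by (rule borel_measurable_continuous_onI)
  then show "(\<lambda>x. emeasure (measure_pmf (\<mu> x i)) A) \<in> borel_measurable borel"
    by (simp add: measure_pmf.emeasure_eq_measure)
qed (auto intro: measure_pmf.subprob_space_axioms)

lemma borel_measurable_expectation:
  fixes \<mu> :: "'a::metric_space \<Rightarrow> 'd \<Rightarrow> 'b::countable pmf" and f :: "'a \<Rightarrow> 'b \<Rightarrow> real"
  assumes "continuous_map euclidean (product_topology (\<lambda>_. weak_topology) UNIV) \<mu>"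
    and [measurable]: "\<And>k. (\<lambda>x. f x k) \<in> borel_measurable borel"
    and nonneg: "\<And>x k. 0 \<le> f x k"
  shows "(\<lambda>x. measure_pmf.expectation (\<mu> x i) (f x)) \<in> borel_measurable borel"
proof -
  note measurable_kernel[OF assms(1), of i, measurable]
  have "(\<lambda>(x, k). ennreal (f x k)) \<in> borel_measurable (borel \<Otimes>\<^sub>M count_space UNIV)"
    unfolding case_prod_unfold
    by (rule measurable_compose_countable[where g = snd and f = "\<lambda>k p. ennreal (f (fst p) k)"]) auto
  then have "(\<lambda>x. \<integral>\<^sup>+k. ennreal (f x k) \<partial>measure_pmf (\<mu> x i)) \<in> borel_measurable borel"
    by (intro nn_integral_measurable_subprob_algebra2[where N="count_space UNIV"]) auto
  then have "(\<lambda>x. enn2real (\<integral>\<^sup>+k. ennreal (f x k) \<partial>measure_pmf (\<mu> x i))) \<in> borel_measurable borel"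
    by measurable
  then show ?thesis
    by (subst integral_eq_nn_integral) (auto simp: nonneg)
qed

section \<open>The generating function of the process\<close>

definition law_gf :: "(nat^'d) pmf \<Rightarrow> real^'d::finite \<Rightarrow> real" where
  "law_gf P s = measure_pmf.expectation P (vpow s)"

text \<open>The composition \<open>\<phi>\<^sub>x \<circ> \<phi>\<^bsub>T x\<^esub> \<circ> \<dots> \<circ> \<phi>\<^bsub>T\<^sup>n\<^sup>-\<^sup>1 x\<^esub>\<close> of the vector-valued offspring generating
functions. The recursion peels off the first generation, as required for the equation
relating \<open>x\<close> and \<open>T x\<close>; the process is defined by adding a last generation, for which
\<open>iterated_gf_Suc_right\<close> is used.\<close>

primrec iterated_gf where
  "iterated_gf T \<mu> 0 x s = s"
| "iterated_gf T \<mu> (Suc n) x s = (\<chi> i. law_gf (\<mu> x i) (iterated_gf T \<mu> n (T x) s))"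

lemma law_gf_unit_cube:
  assumes "s \<in> unit_cube"
  shows "0 \<le> law_gf P s" "law_gf P s \<le> 1"
  unfolding law_gf_def using assms
  by (auto intro!: Bochner_Integration.integral_nonneg measure_pmf.integral_le_const integrable_vpow
           simp: vpow_nonneg vpow_le_1)

lemma iterated_gf_unit_cube: "s \<in> unit_cube \<Longrightarrow> iterated_gf T \<mu> n x s \<in> unit_cube"
  by (induction n arbitrary: x) (auto simp: law_gf_unit_cube unit_cube_def[of] intro!: law_gf_unit_cube)

lemma iterated_gf_Suc_right:
  "iterated_gf T \<mu> (Suc n) x s = iterated_gf T \<mu> n x (\<chi> i. law_gf (\<mu> ((T ^^ n) x) i) s)"
  by (induction n arbitrary: x) (auto simp: funpow_swap1)

lemma gw_process_cong:
  assumes "\<And>m k i. m < n \<Longrightarrow> \<omega> (m, k, i) = \<omega>' (m, k, i)"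
  shows "gw_process \<omega> z n = gw_process \<omega>' z n"
  using assms by (induction n) (auto simp: vec_eq_iff)

text \<open>Countability of the target is what makes addition measurable for the discrete \<open>\<sigma>\<close>-algebra.\<close>

lemma measurable_sum_count_space:
  fixes f :: "'i \<Rightarrow> 'a \<Rightarrow> 'b :: {countable, comm_monoid_add}"
  assumes "finite I" "\<And>i. i \<in> I \<Longrightarrow> f i \<in> measurable M (count_space UNIV)"
  shows "(\<lambda>\<omega>. \<Sum>i\<in>I. f i \<omega>) \<in> measurable M (count_space UNIV)"
  using assms
proof (induction I rule: finite_induct)
  case (insert i I)
  have "(\<lambda>\<omega>. y + (\<Sum>i\<in>I. f i \<omega>)) \<in> measurable M (count_space UNIV)" for y
  proof (rule measurable_compose[where g = "\<lambda>a. y + a"])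
    show "(\<lambda>\<omega>. \<Sum>i\<in>I. f i \<omega>) \<in> measurable M (count_space UNIV)"
      using insert by simp
  qed simp
  then have "(\<lambda>\<omega>. (\<lambda>y \<omega>. y + (\<Sum>i\<in>I. f i \<omega>)) (f i \<omega>) \<omega>) \<in> measurable M (count_space UNIV)"
    by (rule measurable_compose_countable) (rule insert.prems, simp)
  with insert.hyps show ?case by simp
qed simp

lemma vpow_sum: "finite A \<Longrightarrow> vpow s (\<Sum>a\<in>A. f a) = (\<Prod>a\<in>A. vpow s (f a))"
  by (induction A rule: finite_induct) (auto simp: vpow_add)

lemma vpow_gw_process_Suc:
  "vpow s (gw_process \<omega> z (Suc n)) =
     (\<Prod>i\<in>UNIV. \<Prod>k=1..gw_process \<omega> z n $ i. vpow s (\<omega> (n, k, i)))"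
proof -
  have "gw_process \<omega> z (Suc n) = (\<Sum>i\<in>UNIV. \<Sum>k=1..gw_process \<omega> z n $ i. \<omega> (n, k, i))"
    by (simp add: vec_eq_iff)
  then show ?thesis by (simp add: vpow_sum del: gw_process.simps)
qed

context
  fixes T :: "'a \<Rightarrow> 'a" and \<mu> :: "'a \<Rightarrow> 'd::finite \<Rightarrow> (nat^'d) pmf" and x :: 'a
begin

abbreviation law :: "nat \<times> nat \<times> 'd \<Rightarrow> (nat^'d) measure" where
  "law \<equiv> \<lambda>(n, k, i). measure_pmf (\<mu> ((T ^^ n) x) i)"

lemma prob_space_law: "prob_space (law c)"
  by (auto split: prod.split intro: measure_pmf.prob_space_axioms)

lemma sets_law [simp, measurable_cong]: "sets (law c) = sets (count_space UNIV)"
  by (auto split: prod.split)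

lemma space_law [simp]: "space (law c) = UNIV"
  by (auto split: prod.split)

interpretation OM: product_prob_space law UNIV
  by (intro product_prob_spaceI prob_space_law)

lemma prob_space_offspring: "prob_space (offspring_measure T \<mu> x)"
  unfolding offspring_measure_def by (rule OM.P.prob_space_axioms)

lemma measurable_coordinate: "c \<in> J \<Longrightarrow> (\<lambda>\<omega>. \<omega> c) \<in> measurable (PiM J law) (count_space UNIV)"
  using measurable_component_singleton[of c J law] by (simp cong: measurable_cong_sets)

lemma measurable_gw_process:
  assumes "\<And>m k i. m < n \<Longrightarrow> (m, k, i) \<in> J"
  shows "(\<lambda>\<omega>. gw_process \<omega> z n) \<in> measurable (PiM J law) (count_space UNIV)"
  using assms
proof (induction n)
  case (Suc n)
  have [measurable]: "(\<lambda>\<omega>. gw_process \<omega> z n) \<in> measurable (PiM J law) (count_space UNIV)"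
    using Suc by auto
  have coord: "(\<lambda>\<omega>. \<omega> (n, k, i)) \<in> measurable (PiM J law) (count_space UNIV)" for k i
    using Suc.prems by (intro measurable_coordinate) auto
  have "(\<lambda>\<omega>. (\<Sum>i\<in>UNIV. \<Sum>k=1..y $ i. \<omega> (n, k, i))) \<in> measurable (PiM J law) (count_space UNIV)"
    for y :: "nat^'d"
    by (rule measurable_sum_count_space[OF finite measurable_sum_count_space[OF finite_atLeastAtMost coord]])
  then have "(\<lambda>\<omega>. (\<lambda>y \<omega>. \<Sum>i\<in>UNIV. \<Sum>k=1..y $ i. \<omega> (n, k, i)) (gw_process \<omega> z n) \<omega>)
      \<in> measurable (PiM J law) (count_space UNIV)"
    by (rule measurable_compose_countable) measurable
  also have "(\<lambda>\<omega>. (\<lambda>y \<omega>. \<Sum>i\<in>UNIV. \<Sum>k=1..y $ i. \<omega> (n, k, i)) (gw_process \<omega> z n) \<omega>)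
      = (\<lambda>\<omega>. gw_process \<omega> z (Suc n))"
    by (auto simp: fun_eq_iff vec_eq_iff)
  finally show ?case .
qed simp

text \<open>A family of random variables is independent if its joint law is the product of its
marginals, and here the joint law is a product measure by construction.\<close>

lemma indep_coordinates: "OM.P.indep_vars law (\<lambda>c \<omega>. \<omega> c) UNIV"
proof -
  have "distr (PiM UNIV law) (PiM UNIV law) (\<lambda>\<omega>. \<lambda>c\<in>UNIV. \<omega> c)
     = distr (PiM UNIV law) (PiM UNIV law) (\<lambda>\<omega>. \<omega>)"
    by (intro distr_cong) auto
  also have "\<dots> = PiM UNIV law" by simp
  also have "\<dots> = PiM UNIV (\<lambda>c. distr (PiM UNIV law) (law c) (\<lambda>\<omega>. \<omega> c))"
    by (intro PiM_cong distr_PiM_component[symmetric] prob_space_law) auto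
  finally show ?thesis
    by (subst OM.P.indep_vars_iff_distr_eq_PiM) auto
qed

text \<open>The individuals of one generation reproduce independently, so the expectation factorises.\<close>

lemma expectation_generation:
  assumes "s \<in> unit_cube"
  shows "integral\<^sup>L (PiM UNIV law) (\<lambda>\<omega>. \<Prod>i\<in>UNIV. \<Prod>k=1..z $ i. vpow s (\<omega> (n, k, i)))
       = vpow (\<chi> i. law_gf (\<mu> ((T ^^ n) x) i) s) z"
proof -
  let ?A = "\<lambda>i. {1..z $ i}"
  \<comment> \<open>The coordinates that hold the litters of generation \<open>n\<close>.\<close>
  define B where "B = (\<lambda>(i, k). (n, k, i)) ` (SIGMA i:UNIV. ?A i)"
  have inj: "inj_on (\<lambda>(i, k). (n, k, i)) (SIGMA i:UNIV. ?A i)"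
    by (auto simp: inj_on_def)
  have split: "(\<Prod>i\<in>UNIV. \<Prod>k=1..z $ i. h (n, k, i)) = (\<Prod>c\<in>B. h c)" for h :: "_ \<Rightarrow> real"
    unfolding B_def by (subst prod.reindex[OF inj]) (simp add: prod.Sigma case_prod_unfold)
  have meas: "(\<lambda>\<omega>. vpow s (\<omega> c)) \<in> borel_measurable (PiM UNIV law)" for c
    by (rule measurable_compose[OF measurable_coordinate]) auto
  have "OM.P.indep_vars (\<lambda>_. borel) (\<lambda>c \<omega>. vpow s (\<omega> c)) B"
    by (rule OM.P.indep_vars_compose2[OF OM.P.indep_vars_subset[OF indep_coordinates]]) auto
  then have "integral\<^sup>L (PiM UNIV law) (\<lambda>\<omega>. \<Prod>c\<in>B. vpow s (\<omega> c))
      = (\<Prod>c\<in>B. integral\<^sup>L (PiM UNIV law) (\<lambda>\<omega>. vpow s (\<omega> c)))"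
    using assms meas
    by (intro OM.P.indep_vars_lebesgue_integral)
       (auto simp: B_def vpow_abs_le_1 intro!: OM.P.integrable_const_bound[where B=1])
  also have "\<dots> = (\<Prod>(m, k, i)\<in>B. law_gf (\<mu> ((T ^^ m) x) i) s)"
  proof (intro prod.cong refl)
    fix c assume "c \<in> B"
    have "integral\<^sup>L (PiM UNIV law) (\<lambda>\<omega>. vpow s (\<omega> c))
        = integral\<^sup>L (distr (PiM UNIV law) (law c) (\<lambda>\<omega>. \<omega> c)) (vpow s)"
      by (subst integral_distr) (auto intro: measurable_component_singleton)
    also have "distr (PiM UNIV law) (law c) (\<lambda>\<omega>. \<omega> c) = law c"
      by (intro distr_PiM_component prob_space_law) auto
    finally show "integral\<^sup>L (PiM UNIV law) (\<lambda>\<omega>. vpow s (\<omega> c))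
        = (case c of (m, k, i) \<Rightarrow> law_gf (\<mu> ((T ^^ m) x) i) s)"
      by (simp add: law_gf_def split: prod.splits)
  qed
  also have "\<dots> = vpow (\<chi> i. law_gf (\<mu> ((T ^^ n) x) i) s) z"
    by (simp add: split[symmetric] vpow_def)
  finally show ?thesis by (simp only: split[of "\<lambda>c. vpow s (_ c)"])
qed

text \<open>Given the population \<open>z\<close> of generation \<open>n\<close>, the next one has generating function
\<open>vpow (\<phi> s) z\<close> by \<open>expectation_generation\<close>. The population of generation \<open>n\<close> depends only on
coordinates of earlier generations, so Fubini's theorem allows generation \<open>n\<close> to be integrated
out first.\<close>

lemma expectation_vpow_gw_process:
  assumes "s \<in> unit_cube"
  shows "integral\<^sup>L (PiM UNIV law) (\<lambda>\<omega>. vpow s (gw_process \<omega> z n))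
       = vpow (iterated_gf T \<mu> n x s) z"
  using assms
proof (induction n arbitrary: s)
  case 0
  then show ?case by (simp add: OM.P.prob_space)
next
  case (Suc n)
  define s' where "s' = (\<chi> i. law_gf (\<mu> ((T ^^ n) x) i) s)"
  have s': "s' \<in> unit_cube"
    using law_gf_unit_cube[OF Suc.prems] by (auto simp: unit_cube_def s'_def)
  define A where "A = {c :: nat \<times> nat \<times> 'd. fst c < n}"
  define B where "B = {c :: nat \<times> nat \<times> 'd. fst c = n}"
  define X where "X = (\<lambda>\<omega> :: nat \<times> nat \<times> 'd \<Rightarrow> nat^'d. restrict \<omega> A)"
  define Y where "Y = (\<lambda>\<omega> :: nat \<times> nat \<times> 'd \<Rightarrow> nat^'d. restrict \<omega> B)"
  define F where "F y b = (\<Prod>i\<in>UNIV. \<Prod>k=1..y $ i. vpow s (b (n, k, i)))"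
    for y :: "nat^'d" and b :: "nat \<times> nat \<times> 'd \<Rightarrow> nat^'d"
  have F: "0 \<le> F y b" "F y b \<le> 1" for y b
    unfolding F_def using Suc.prems
    by (auto intro!: prod_nonneg prod_le_1 simp: vpow_nonneg vpow_le_1)
  let ?\<Omega> = "PiM UNIV law" and ?A = "PiM A law" and ?B = "PiM B law"
  have indep: "OM.P.indep_var ?A X ?B Y"
    unfolding X_def Y_def
    by (rule OM.P.indep_var_restrict[OF indep_coordinates, of A B, unfolded restrict_def[symmetric]])
       (auto simp: A_def B_def)
  have X[measurable]: "X \<in> measurable ?\<Omega> ?A" and Y[measurable]: "Y \<in> measurable ?\<Omega> ?B"
    using OM.P.indep_var_rv1[OF indep] OM.P.indep_var_rv2[OF indep] by auto
  interpret PA: prob_space "distr ?\<Omega> ?A X" by (rule OM.P.prob_space_distr) measurable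
  interpret PB: prob_space "distr ?\<Omega> ?B Y" by (rule OM.P.prob_space_distr) measurable
  interpret PAB: pair_prob_space "distr ?\<Omega> ?A X" "distr ?\<Omega> ?B Y" ..
  have [measurable]: "(\<lambda>a. gw_process a z n) \<in> measurable ?A (count_space UNIV)"
    by (rule measurable_gw_process) (auto simp: A_def)
  have [measurable]: "(\<lambda>b. vpow s (b (n, k, i))) \<in> borel_measurable ?B" for k i
    by (rule measurable_compose[OF measurable_coordinate]) (auto simp: B_def)
  have Fm[measurable]: "(\<lambda>b. F y b) \<in> borel_measurable ?B" for y
    unfolding F_def by measurable
  have meas: "(\<lambda>(a, b). F (gw_process a z n) b) \<in> borel_measurable (?A \<Otimes>\<^sub>M ?B)"
    unfolding case_prod_unfold
    by (rule measurable_compose_countable[where g = "\<lambda>p. gw_process (fst p) z n" and f = "\<lambda>y p. F y (snd p)"])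
       measurable
  have "integral\<^sup>L ?\<Omega> (\<lambda>\<omega>. vpow s (gw_process \<omega> z (Suc n)))
      = integral\<^sup>L ?\<Omega> (\<lambda>\<omega>. (\<lambda>(a, b). F (gw_process a z n) b) (X \<omega>, Y \<omega>))"
  proof (intro Bochner_Integration.integral_cong refl)
    fix \<omega> :: "nat \<times> nat \<times> 'd \<Rightarrow> nat^'d"
    have "gw_process (X \<omega>) z n = gw_process \<omega> z n"
      by (rule gw_process_cong) (auto simp: X_def A_def)
    then show "vpow s (gw_process \<omega> z (Suc n)) = (\<lambda>(a, b). F (gw_process a z n) b) (X \<omega>, Y \<omega>)"
      by (simp add: vpow_gw_process_Suc F_def Y_def B_def del: gw_process.simps)
  qed
  also have "\<dots> = integral\<^sup>L (distr ?\<Omega> (?A \<Otimes>\<^sub>M ?B) (\<lambda>\<omega>. (X \<omega>, Y \<omega>))) (\<lambda>(a, b). F (gw_process a z n) b)"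
    by (subst integral_distr[OF _ meas]) auto
  also have "distr ?\<Omega> (?A \<Otimes>\<^sub>M ?B) (\<lambda>\<omega>. (X \<omega>, Y \<omega>)) = distr ?\<Omega> ?A X \<Otimes>\<^sub>M distr ?\<Omega> ?B Y"
    using indep unfolding OM.P.indep_var_distribution_eq by simp
  also have "integral\<^sup>L (distr ?\<Omega> ?A X \<Otimes>\<^sub>M distr ?\<Omega> ?B Y) (\<lambda>(a, b). F (gw_process a z n) b)
      = (\<integral>a. (\<integral>b. (\<lambda>(a, b). F (gw_process a z n) b) (a, b) \<partial>distr ?\<Omega> ?B Y) \<partial>distr ?\<Omega> ?A X)"
  proof (rule PAB.integral_fst'[symmetric])
    show "integrable (distr ?\<Omega> ?A X \<Otimes>\<^sub>M distr ?\<Omega> ?B Y) (\<lambda>(a, b). F (gw_process a z n) b)"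
      using F meas by (intro PAB.P.integrable_const_bound[where B=1]) (auto cong: measurable_cong_sets)
  qed
  also have "\<dots> = (\<integral>a. vpow s' (gw_process a z n) \<partial>distr ?\<Omega> ?A X)"
  proof (intro Bochner_Integration.integral_cong refl)
    fix a
    have "(\<integral>b. (\<lambda>(a, b). F (gw_process a z n) b) (a, b) \<partial>distr ?\<Omega> ?B Y)
        = (\<integral>b. F (gw_process a z n) b \<partial>distr ?\<Omega> ?B Y)" by simp
    also have "\<dots> = integral\<^sup>L ?\<Omega> (\<lambda>\<omega>. F (gw_process a z n) (Y \<omega>))"
      by (rule integral_distr) measurable
    also have "\<dots> = integral\<^sup>L ?\<Omega> (\<lambda>\<omega>. F (gw_process a z n) \<omega>)"
      by (intro Bochner_Integration.integral_cong refl) (simp add: F_def Y_def B_def)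
    also have "\<dots> = vpow s' (gw_process a z n)"
      unfolding F_def s'_def by (rule expectation_generation[OF Suc.prems])
    finally show "(\<integral>b. (\<lambda>(a, b). F (gw_process a z n) b) (a, b) \<partial>distr ?\<Omega> ?B Y) = vpow s' (gw_process a z n)" .
  qed
  also have "\<dots> = integral\<^sup>L ?\<Omega> (\<lambda>\<omega>. vpow s' (gw_process (X \<omega>) z n))"
    by (rule integral_distr) measurable
  also have "\<dots> = integral\<^sup>L ?\<Omega> (\<lambda>\<omega>. vpow s' (gw_process \<omega> z n))"
  proof (intro Bochner_Integration.integral_cong refl)
    fix \<omega> :: "nat \<times> nat \<times> 'd \<Rightarrow> nat^'d"
    have "gw_process (X \<omega>) z n = gw_process \<omega> z n"
      by (rule gw_process_cong) (auto simp: X_def A_def)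
    then show "vpow s' (gw_process (X \<omega>) z n) = vpow s' (gw_process \<omega> z n)" by simp
  qed
  also have "\<dots> = vpow (iterated_gf T \<mu> n x s') z" by (rule Suc.IH[OF s'])
  also have "iterated_gf T \<mu> n x s' = iterated_gf T \<mu> (Suc n) x s"
    unfolding s'_def by (rule iterated_gf_Suc_right[symmetric])
  finally show ?case .
qed

lemma prob_extinct_at:
  "measure (offspring_measure T \<mu> x) {\<omega>\<in>space (offspring_measure T \<mu> x). gw_process \<omega> (axis i 1) n = 0}
    = iterated_gf T \<mu> n x 0 $ i"
proof -
  let ?E = "{\<omega>\<in>space (PiM UNIV law). gw_process \<omega> (axis i 1) n = 0}"
  have [measurable]: "(\<lambda>\<omega>. gw_process \<omega> (axis i 1) n) \<in> measurable (PiM UNIV law) (count_space UNIV)"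
    by (rule measurable_gw_process) auto
  have zero: "vpow 0 k = (if k = 0 then 1 else 0)" for k :: "nat^'d"
    by (auto simp: vpow_def vec_eq_iff)
  have "measure (PiM UNIV law) ?E = integral\<^sup>L (PiM UNIV law) (indicator ?E)"
    by (simp add: Int_absorb2)
  also have "\<dots> = integral\<^sup>L (PiM UNIV law) (\<lambda>\<omega>. vpow 0 (gw_process \<omega> (axis i 1) n))"
    by (intro Bochner_Integration.integral_cong) (auto simp: zero indicator_def)
  also have "\<dots> = iterated_gf T \<mu> n x 0 $ i"
    by (simp add: expectation_vpow_gw_process zero_one_unit_cube)
  finally show ?thesis by (simp add: offspring_measure_def)
qed

lemma extinct_Suc: "gw_process \<omega> z n = 0 \<Longrightarrow> gw_process \<omega> z (Suc n) = 0"
  by (simp add: vec_eq_iff)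

text \<open>The empty population is absorbing, so the extinction events increase with \<open>n\<close>.\<close>

lemma extinction_prob_limit:
  "(\<lambda>n. iterated_gf T \<mu> n x 0 $ i) \<longlonglongrightarrow> extinction_prob T \<mu> x $ i"
proof -
  let ?M = "offspring_measure T \<mu> x"
  interpret M: prob_space ?M by (rule prob_space_offspring)
  define E where "E n = {\<omega>\<in>space ?M. gw_process \<omega> (axis i 1) n = 0}" for n
  have [measurable]: "(\<lambda>\<omega>. gw_process \<omega> (axis i 1) n) \<in> measurable ?M (count_space UNIV)" for n
    unfolding offspring_measure_def by (rule measurable_gw_process) auto
  have E: "range E \<subseteq> sets ?M"
    unfolding E_def by auto
  have "incseq E"
    by (rule incseq_SucI) (auto simp: E_def simp del: gw_process.simps intro: extinct_Suc)
  from M.finite_Lim_measure_incseq[OF E this]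
  have "(\<lambda>n. M.prob (E n)) \<longlonglongrightarrow> M.prob (\<Union>n. E n)" .
  also have "(\<lambda>n. M.prob (E n)) = (\<lambda>n. iterated_gf T \<mu> n x 0 $ i)"
    by (simp add: E_def prob_extinct_at fun_eq_iff)
  also have "(\<Union>n. E n) = {\<omega>\<in>space ?M. \<exists>n. gw_process \<omega> (axis i 1) n = 0}"
    by (auto simp: E_def)
  finally show ?thesis by (simp add: extinction_prob_def)
qed

end

lemma survive_prob_eq_law_gf:
  assumes "p \<in> unit_cube"
  shows "survive_prob P p = 1 - law_gf P (1 - p)"
  unfolding survive_prob_def law_gf_def
  using integrable_vpow[OF one_minus_unit_cube[OF assms], of P] by simp

lemma survive_prob_0 [simp]: "survive_prob P 0 = 0"
  by (simp add: survive_prob_def)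

section \<open>Averages of real sequences\<close>

text \<open>Fekete's subadditive lemma: the limit is \<open>L = inf\<^sub>n a\<^sub>n / n\<close>. Divide \<open>n\<close> with remainder by an \<open>m\<close> for
which \<open>a\<^sub>m / m\<close> is close to \<open>L\<close>; the remainder contributes a bounded term \<open>K\<close>.\<close>

lemma fekete_real:
  fixes a :: "nat \<Rightarrow> real"
  assumes sub: "\<And>m n. a (m + n) \<le> a m + a n" and lower: "\<And>n. c * real n \<le> a n"
  shows "convergent (\<lambda>n. 1 / real n * a n)"
proof -
  define L where "L = (INF n\<in>{1..}. a n / real n)"
  have bdd: "bdd_below ((\<lambda>n. a n / real n) ` {1..})"
    using lower by (intro bdd_belowI2[of _ c]) (auto simp: pos_le_divide_eq)
  have L: "L \<le> a n / real n" if "n \<ge> 1" for n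
    unfolding L_def using bdd that by (intro cINF_lower) auto
  have mult: "a (q * m) \<le> real q * a m + max 0 (a 0)" for q m
  proof (induction q)
    case (Suc q)
    have "a (Suc q * m) \<le> a m + a (q * m)" using sub[of m "q * m"] by simp
    with Suc show ?case by (simp add: algebra_simps)
  qed simp
  have "(\<lambda>n. a n / real n) \<longlonglongrightarrow> L"
  proof (rule LIMSEQ_I)
    fix e :: real assume e: "0 < e"
    have "\<exists>m\<in>{1..}. a m / real m < L + e / 2"
      using cINF_less_iff[OF _ bdd, of "L + e / 2"] e unfolding L_def by auto
    then obtain m where m: "1 \<le> m" "a m / real m < L + e / 2" by auto
    define K where "K = Max ((\<lambda>r. \<bar>a r\<bar>) ` {..<m}) + \<bar>a m / real m\<bar> * m + max 0 (a 0)"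
    have bound: "a n / real n \<le> a m / real m + K / real n" if n: "1 \<le> n" for n
    proof -
      define q r where "q = n div m" and "r = n mod m"
      have n_eq: "n = q * m + r" and r: "r < m" using m by (auto simp: q_def r_def)
      have "a n \<le> a (q * m) + a r" unfolding n_eq by (rule sub)
      moreover have "a (q * m) \<le> real q * a m + max 0 (a 0)" by (rule mult)
      moreover have "a r \<le> \<bar>a r\<bar>" by simp
      moreover have "\<bar>a r\<bar> \<le> Max ((\<lambda>r. \<bar>a r\<bar>) ` {..<m})" using r by (intro Max_ge) auto
      moreover have "real q * a m = real n * (a m / real m) - real r * (a m / real m)"
        using m unfolding n_eq by (simp add: field_simps)
      moreover have "- (real r * (a m / real m)) \<le> \<bar>a m / real m\<bar> * real m"
      proof -
        have "- (real r * (a m / real m)) \<le> real r * \<bar>a m / real m\<bar>"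
          by (metis abs_ge_minus_self abs_mult abs_of_nat)
        also have "\<dots> \<le> real m * \<bar>a m / real m\<bar>" using r by (intro mult_right_mono) auto
        finally show ?thesis by (simp add: mult.commute)
      qed
      ultimately have "a n \<le> real n * (a m / real m) + K"
        unfolding K_def by linarith
      then have "a n / real n \<le> (real n * (a m / real m) + K) / real n"
        using n by (intro divide_right_mono) auto
      also have "\<dots> = a m / real m + K / real n"
        using n by (simp add: add_divide_distrib)
      finally show ?thesis .
    qed
    have "(\<lambda>n. K / real n) \<longlonglongrightarrow> 0" by (rule lim_const_over_n)
    then obtain N where N: "\<And>n. n \<ge> N \<Longrightarrow> \<bar>K / real n\<bar> < e / 2"
      using e LIMSEQ_D[of _ 0 "e / 2"] by fastforce
    show "\<exists>no. \<forall>n\<ge>no. norm (a n / real n - L) < e"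
    proof (intro exI[of _ "max 1 N"] allI impI)
      fix n assume "max 1 N \<le> n"
      then show "norm (a n / real n - L) < e"
        using bound[of n] N[of n] L[of n] m(2) unfolding real_norm_def by linarith
    qed
  qed
  then show ?thesis by (auto simp: convergent_def)
qed

lemma cesaro_null:
  fixes a :: "nat \<Rightarrow> real"
  assumes "a \<longlonglongrightarrow> 0"
  shows "(\<lambda>n. 1 / real n * (\<Sum>k<n. a k)) \<longlonglongrightarrow> 0"
proof (rule LIMSEQ_I)
  fix e :: real assume e: "0 < e"
  then obtain M where M: "\<And>k. k \<ge> M \<Longrightarrow> \<bar>a k\<bar> < e / 2"
    using LIMSEQ_D[OF assms, of "e / 2"] by auto
  define S where "S = (\<Sum>k<M. \<bar>a k\<bar>)"
  have "(\<lambda>n. S / real n) \<longlonglongrightarrow> 0" by (rule lim_const_over_n)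
  then obtain N where N: "\<And>n. n \<ge> N \<Longrightarrow> \<bar>S / real n\<bar> < e / 2"
    using e LIMSEQ_D[of _ 0 "e / 2"] by fastforce
  have "norm (1 / real n * (\<Sum>k<n. a k) - 0) < e" if n: "n \<ge> Suc (N + M)" for n
  proof -
    have "\<bar>\<Sum>k<n. a k\<bar> \<le> (\<Sum>k<n. \<bar>a k\<bar>)" by (rule sum_abs)
    also have "\<dots> \<le> (\<Sum>k<n. (if k < M then \<bar>a k\<bar> else 0) + e / 2)"
      using M e by (intro sum_mono) (auto simp: not_less less_imp_le)
    also have "\<dots> = (\<Sum>k<n. if k < M then \<bar>a k\<bar> else 0) + real n * (e / 2)"
      by (simp add: sum.distrib)
    also have "(\<Sum>k<n. if k < M then \<bar>a k\<bar> else 0) = S"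
      unfolding S_def using n by (intro sum.mono_neutral_cong_right) auto
    finally have "\<bar>\<Sum>k<n. a k\<bar> / real n \<le> (S + real n * (e / 2)) / real n"
      by (intro divide_right_mono) auto
    also have "\<dots> = S / real n + e / 2" using n by (simp add: add_divide_distrib)
    also have "\<dots> < e" using N[of n] n by linarith
    finally show ?thesis using n by (simp add: abs_mult)
  qed
  then show "\<exists>no. \<forall>n\<ge>no. norm (1 / real n * (\<Sum>k<n. a k) - 0) < e" by blast
qed

section \<open>Invariant measures\<close>

locale invariant_measure = prob_space \<nu> for \<nu> :: "'a measure" and T :: "'a \<Rightarrow> 'a" +
  assumes T_measurable [measurable]: "T \<in> measurable \<nu> \<nu>"
    and invariant: "distr \<nu> \<nu> T = \<nu>"
begin

lemma funpow_measurable [measurable]: "(T ^^ n) \<in> measurable \<nu> \<nu>"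
  by (induction n) (auto intro: measurable_comp)

lemma distr_funpow: "distr \<nu> \<nu> (T ^^ n) = \<nu>"
proof (induction n)
  case (Suc n)
  have "distr \<nu> \<nu> (T ^^ Suc n) = distr (distr \<nu> \<nu> (T ^^ n)) \<nu> T"
    by (simp add: distr_distr)
  with Suc invariant show ?case by (simp only:)
qed (simp add: distr_id)

lemma integral_funpow:
  fixes f :: "'a \<Rightarrow> real"
  assumes "f \<in> borel_measurable \<nu>"
  shows "(\<integral>x. f ((T ^^ n) x) \<partial>\<nu>) = integral\<^sup>L \<nu> f"
  using integral_distr[OF funpow_measurable assms, of n] by (simp add: distr_funpow)

text \<open>The function \<open>g\<close> itself need not be integrable. Truncating \<open>g\<close> at \<open>\<plusminus>n\<close> does not increase \<open>\<bar>g \<circ> T - g\<bar>\<close>,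
and for the truncation the claim is invariance; the bound \<open>B\<close> allows passage to the limit.\<close>

lemma integral_coboundary:
  fixes g :: "'a \<Rightarrow> real"
  assumes g [measurable]: "g \<in> borel_measurable \<nu>"
    and bound: "\<And>x. x \<in> space \<nu> \<Longrightarrow> \<bar>g (T x) - g x\<bar> \<le> B"
  shows "(\<integral>x. g (T x) - g x \<partial>\<nu>) = 0"
proof -
  define h where "h n x = max (- real n) (min (real n) (g x))" for n x
  have [measurable]: "h n \<in> borel_measurable \<nu>" for n unfolding h_def by measurable
  have int: "integrable \<nu> (h n)" for n
    by (rule integrable_const_bound[where B = "real n"]) (auto simp: h_def)
  have intT: "integrable \<nu> (\<lambda>x. h n (T x))" for n
    by (rule integrable_const_bound[where B = "real n"]) (auto simp: h_def)
  have "(\<integral>x. h n (T x) - h n x \<partial>\<nu>) = 0" for n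
    using int[of n] intT[of n] integral_distr[of T \<nu> \<nu> "h n"] by (simp add: invariant)
  moreover have "(\<lambda>n. \<integral>x. h n (T x) - h n x \<partial>\<nu>) \<longlonglongrightarrow> (\<integral>x. g (T x) - g x \<partial>\<nu>)"
  proof (rule integral_dominated_convergence[where w = "\<lambda>_. B"])
    have ev: "eventually (\<lambda>n. h n x = g x) sequentially" for x
    proof -
      have "eventually (\<lambda>n. \<bar>g x\<bar> \<le> real n) sequentially"
        using eventually_ge_at_top[of "nat \<lceil>\<bar>g x\<bar>\<rceil>"] by eventually_elim linarith
      then show ?thesis by eventually_elim (auto simp: h_def)
    qed
    show "AE x in \<nu>. (\<lambda>n. h n (T x) - h n x) \<longlonglongrightarrow> g (T x) - g x"
      by (intro AE_I2 tendsto_diff tendsto_eventually ev)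
    show "AE x in \<nu>. norm (h n (T x) - h n x) \<le> B" for n
    proof (rule AE_I2)
      fix x assume "x \<in> space \<nu>"
      have "\<bar>h n (T x) - h n x\<bar> \<le> \<bar>g (T x) - g x\<bar>" by (auto simp: h_def)
      also have "\<dots> \<le> B" by (rule bound) fact
      finally show "norm (h n (T x) - h n x) \<le> B" by simp
    qed
  qed auto
  ultimately show ?thesis by (simp add: LIMSEQ_const_iff)
qed

end

section \<open>Non-negative matrices and the row sum norm\<close>

lemma row_sum_norm_ge: "(\<Sum>j\<in>UNIV. \<bar>A $ i $ j\<bar>) \<le> row_sum_norm A"
  by (auto simp: row_sum_norm_def)

lemma row_sum_norm_le_iff: "row_sum_norm A \<le> b \<longleftrightarrow> (\<forall>i. (\<Sum>j\<in>UNIV. \<bar>A $ i $ j\<bar>) \<le> b)"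
  by (auto simp: row_sum_norm_def)

lemma row_sum_norm_nonneg: "0 \<le> row_sum_norm A"
  using row_sum_norm_ge[of A undefined] by (meson abs_ge_zero order_trans sum_nonneg)

lemma row_sum_norm_mult: "row_sum_norm (A ** B) \<le> row_sum_norm A * row_sum_norm B"
  unfolding row_sum_norm_le_iff
proof
  fix i
  have "(\<Sum>j\<in>UNIV. \<bar>(A ** B) $ i $ j\<bar>) \<le> (\<Sum>j\<in>UNIV. \<Sum>k\<in>UNIV. \<bar>A $ i $ k\<bar> * \<bar>B $ k $ j\<bar>)"
    unfolding matrix_matrix_mult_def by (intro sum_mono) (simp add: abs_mult[symmetric])
  also have "\<dots> = (\<Sum>k\<in>UNIV. \<bar>A $ i $ k\<bar> * (\<Sum>j\<in>UNIV. \<bar>B $ k $ j\<bar>))"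
    by (subst sum.swap) (simp add: sum_distrib_left)
  also have "\<dots> \<le> (\<Sum>k\<in>UNIV. \<bar>A $ i $ k\<bar> * row_sum_norm B)"
    by (intro sum_mono mult_left_mono row_sum_norm_ge) auto
  also have "\<dots> \<le> row_sum_norm A * row_sum_norm B"
    unfolding sum_distrib_right[symmetric]
    by (intro mult_right_mono row_sum_norm_ge row_sum_norm_nonneg)
  finally show "(\<Sum>j\<in>UNIV. \<bar>(A ** B) $ i $ j\<bar>) \<le> row_sum_norm A * row_sum_norm B" .
qed

lemma row_sum_norm_mat_1 [simp]: "row_sum_norm (mat 1 :: real^'d^'d::finite) = 1"
proof -
  have "(\<Sum>j\<in>UNIV. \<bar>(mat 1 :: real^'d^'d) $ i $ j\<bar>) = 1" for i :: 'd
  proof -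
    have "(\<Sum>j\<in>UNIV. \<bar>(mat 1 :: real^'d^'d) $ i $ j\<bar>) = (\<Sum>j\<in>UNIV. if j = i then 1 else 0)"
      by (intro sum.cong) (auto simp: mat_def)
    then show ?thesis by simp
  qed
  then show ?thesis by (simp add: row_sum_norm_def)
qed

text \<open>The sum of the entries is the norm on non-negative row vectors that matches the maximal row sum: this
bound and the next one, for the all-ones vector, translate between the matrix norm and the vector
inequalities for survival probabilities.\<close>

lemma sum_vector_matrix_le:
  assumes "\<And>i. 0 \<le> v $ i" "\<And>i j. 0 \<le> A $ i $ j"
  shows "(\<Sum>j\<in>UNIV. (v v* A) $ j) \<le> (\<Sum>i\<in>UNIV. v $ i) * row_sum_norm A"
proof -
  have "(\<Sum>j\<in>UNIV. (v v* A) $ j) = (\<Sum>i\<in>UNIV. v $ i * (\<Sum>j\<in>UNIV. \<bar>A $ i $ j\<bar>))"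
    unfolding vector_matrix_mult_def using assms
    by (simp add: sum_distrib_left) (subst sum.swap, simp add: mult.commute)
  also have "\<dots> \<le> (\<Sum>i\<in>UNIV. v $ i * row_sum_norm A)"
    using assms by (intro sum_mono mult_left_mono row_sum_norm_ge)
  finally show ?thesis by (simp add: sum_distrib_right)
qed

lemma row_sum_norm_le_sum_vector_matrix:
  assumes "\<And>i j. 0 \<le> A $ i $ j"
  shows "row_sum_norm A \<le> (\<Sum>j\<in>UNIV. (1 v* A) $ j)"
  unfolding row_sum_norm_le_iff
proof
  fix i
  have "(\<Sum>j\<in>UNIV. \<bar>A $ i $ j\<bar>) \<le> (\<Sum>i\<in>UNIV. \<Sum>j\<in>UNIV. \<bar>A $ i $ j\<bar>)"
    by (intro member_le_sum) (auto intro: sum_nonneg)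
  also have "\<dots> = (\<Sum>j\<in>UNIV. (1 v* A) $ j)"
    unfolding vector_matrix_mult_def using assms by (subst sum.swap) simp
  finally show "(\<Sum>j\<in>UNIV. \<bar>A $ i $ j\<bar>) \<le> (\<Sum>j\<in>UNIV. (1 v* A) $ j)" .
qed

lemma vector_matrix_mono:
  fixes v w :: "real^'d" and A :: "real^'e^'d"
  assumes "\<And>i. v $ i \<le> w $ i" "\<And>i j. 0 \<le> A $ i $ j"
  shows "(v v* A) $ j \<le> (w v* A) $ j"
  unfolding vector_matrix_mult_def using assms by (auto intro!: sum_mono mult_right_mono)

lemma mean_cocycle_add:
  "mean_cocycle T \<mu> (m + n) x = mean_cocycle T \<mu> m ((T ^^ n) x) ** mean_cocycle T \<mu> n x"
proof (induction m)
  case (Suc m)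
  have "(T ^^ (m + n)) x = (T ^^ m) ((T ^^ n) x)" by (simp add: funpow_add)
  with Suc show ?case by (simp add: matrix_mul_assoc)
qed simp

section \<open>Survival vectors\<close>

text \<open>The quantitative content of the hypotheses: the means lie between \<open>C\<close> and \<open>D\<close>, and every individual
has a child of any given type with probability at least \<open>\<kappa>\<close>, uniformly in the environment.\<close>

locale branching_environment =
  fixes T :: "'a::metric_space \<Rightarrow> 'a"
    and \<mu> :: "'a \<Rightarrow> 'd::finite \<Rightarrow> (nat^'d) pmf"
    and C D \<kappa> :: real
  assumes T_borel [measurable]: "T \<in> borel_measurable borel"
    and law_continuous: "continuous_map euclidean (product_topology (\<lambda>_. weak_topology) UNIV) \<mu>"
    and branching: "\<And>x i. pmf (\<mu> x i) 0 + (\<Sum>j\<in>UNIV. pmf (\<mu> x i) (axis j 1)) < 1"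
    and finite_mean: "\<And>x i. finite_mean (\<mu> x i)"
    and mean_matrix: "\<And>x i j. mean_matrix \<mu> x $ j $ i = mean_offspring (\<mu> x i) j"
    and C_pos: "0 < C"
    and mean_ge: "\<And>x i j. C \<le> mean_matrix \<mu> x $ i $ j"
    and mean_le: "\<And>x i j. mean_matrix \<mu> x $ i $ j \<le> D"
    and \<kappa>_pos: "0 < \<kappa>"
    and \<kappa>_le: "\<And>x i j. \<kappa> \<le> measure_pmf.prob (\<mu> x i) {k. k $ j \<noteq> 0}"
begin

lemma D_pos: "0 < D"
  using C_pos mean_ge mean_le by (meson less_le_trans order_trans)

definition survival :: "nat \<Rightarrow> 'a \<Rightarrow> real^'d" where
  "survival n x = 1 - iterated_gf T \<mu> n x 0"

definition limit_survival :: "'a \<Rightarrow> real^'d" where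
  "limit_survival x = 1 - extinction_prob T \<mu> x"

lemma survival_unit_cube: "survival n x \<in> unit_cube"
  unfolding survival_def by (intro one_minus_unit_cube iterated_gf_unit_cube zero_one_unit_cube)

lemma survival_0 [simp]: "survival 0 x = 1"
  by (simp add: survival_def)

lemma survival_Suc: "survival (Suc n) x $ i = survive_prob (\<mu> x i) (survival n (T x))"
  by (subst survive_prob_eq_law_gf[OF survival_unit_cube]) (simp add: survival_def)

lemma survival_tendsto: "(\<lambda>n. survival n x $ i) \<longlonglongrightarrow> limit_survival x $ i"
  unfolding survival_def limit_survival_def
  by (simp, intro tendsto_diff tendsto_const extinction_prob_limit)

lemma limit_survival_unit_cube: "limit_survival x \<in> unit_cube"
  using survival_unit_cube unfolding unit_cube_def
  by (auto intro: LIMSEQ_le_const[OF survival_tendsto] LIMSEQ_le_const2[OF survival_tendsto])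

lemma limit_survival_fixed_point:
  "limit_survival x $ i = survive_prob (\<mu> x i) (limit_survival (T x))"
proof (rule LIMSEQ_unique)
  show "(\<lambda>n. survival (Suc n) x $ i) \<longlonglongrightarrow> limit_survival x $ i"
    by (rule LIMSEQ_Suc[OF survival_tendsto])
  show "(\<lambda>n. survival (Suc n) x $ i) \<longlonglongrightarrow> survive_prob (\<mu> x i) (limit_survival (T x))"
    unfolding survival_Suc by (intro tendsto_survive_prob survival_unit_cube survival_tendsto)
qed

lemma vector_mean_matrix:
  "(p v* mean_matrix \<mu> x) $ i = (\<Sum>j\<in>UNIV. mean_offspring (\<mu> x i) j * p $ j)"
  by (simp add: vector_matrix_mult_def mean_matrix mult.commute)

lemma survive_prob_ge_\<kappa>:
  assumes "p \<in> unit_cube"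
  shows "\<kappa> * p $ j \<le> survive_prob (\<mu> x i) p"
proof -
  have "\<kappa> * p $ j \<le> measure_pmf.prob (\<mu> x i) {k. k $ j \<noteq> 0} * p $ j"
    using assms \<kappa>_le by (intro mult_right_mono) (auto simp: unit_cube_def)
  also have "\<dots> \<le> survive_prob (\<mu> x i) p" by (rule survive_prob_ge[OF assms])
  finally show ?thesis .
qed

lemma survive_prob_le_linear:
  "p \<in> unit_cube \<Longrightarrow> survive_prob (\<mu> x i) p \<le> (p v* mean_matrix \<mu> x) $ i"
  unfolding vector_mean_matrix by (intro survive_prob_le_mean finite_mean)

lemma linear_le:
  assumes "p \<in> unit_cube"
  shows "(p v* mean_matrix \<mu> x) $ i \<le> D * (\<Sum>j\<in>UNIV. p $ j)"
  unfolding vector_matrix_mult_def sum_distrib_left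
  using assms mean_le by (auto intro!: sum_mono mult_left_mono simp: unit_cube_def mult.commute[of D])

text \<open>The nonlinear map and its linearisation are comparable up to a factor that depends neither on
the environment nor on \<open>p\<close>. This makes all logarithmic quantities below bounded, hence integrable.\<close>

lemma linear_le_distortion:
  assumes "p \<in> unit_cube"
  shows "(p v* mean_matrix \<mu> x) $ i \<le> (real CARD('d) * D / \<kappa>) * survive_prob (\<mu> x i) p"
proof -
  have "(p v* mean_matrix \<mu> x) $ i \<le> D * (\<Sum>j\<in>UNIV. p $ j)" by (rule linear_le[OF assms])
  also have "\<dots> \<le> D * (\<Sum>j\<in>(UNIV :: 'd set). survive_prob (\<mu> x i) p / \<kappa>)"
    using survive_prob_ge_\<kappa>[OF assms] \<kappa>_pos D_pos
    by (intro mult_left_mono sum_mono) (auto simp: pos_le_divide_eq mult.commute)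
  finally show ?thesis by (simp add: field_simps)
qed

lemma bad_iff: "x \<in> bad_environments T \<mu> \<longleftrightarrow> limit_survival x = 0"
  by (auto simp: bad_environments_def limit_survival_def)

text \<open>One direction is the fixed point equation; the other holds since an individual has children of each
type with positive probability, so certain extinction forces certain extinction of every child.\<close>

lemma bad_T_iff: "T x \<in> bad_environments T \<mu> \<longleftrightarrow> x \<in> bad_environments T \<mu>"
proof
  assume "T x \<in> bad_environments T \<mu>"
  then show "x \<in> bad_environments T \<mu>"
    by (simp add: bad_iff vec_eq_iff[of "limit_survival x"] limit_survival_fixed_point[of x])
next
  assume "x \<in> bad_environments T \<mu>"
  then have "\<kappa> * limit_survival (T x) $ j \<le> 0" for j
    using survive_prob_ge_\<kappa>[OF limit_survival_unit_cube, of "T x" j x undefined]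
    by (simp add: bad_iff flip: limit_survival_fixed_point)
  then have "limit_survival (T x) $ j = 0" for j
    using \<kappa>_pos unit_cubeD(1)[OF limit_survival_unit_cube, of "T x" j]
    by (smt (verit) mult_pos_pos)
  then show "T x \<in> bad_environments T \<mu>" by (simp add: bad_iff vec_eq_iff)
qed

lemma bad_funpow_iff: "(T ^^ n) x \<in> bad_environments T \<mu> \<longleftrightarrow> x \<in> bad_environments T \<mu>"
  by (induction n) (auto simp: bad_T_iff)

text \<open>An individual of type \<open>i\<close> has a child of a surviving type with positive probability.\<close>

lemma limit_survival_pos:
  assumes "x \<notin> bad_environments T \<mu>"
  shows "0 < limit_survival x $ i"
proof -
  have "limit_survival (T x) \<noteq> 0" using assms bad_T_iff bad_iff by blast
  then obtain j where "limit_survival (T x) $ j \<noteq> 0" by (auto simp: vec_eq_iff)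
  then have "0 < limit_survival (T x) $ j"
    using unit_cubeD(1)[OF limit_survival_unit_cube, of "T x" j] by simp
  then have "0 < \<kappa> * limit_survival (T x) $ j" using \<kappa>_pos by simp
  also have "\<dots> \<le> limit_survival x $ i"
    unfolding limit_survival_fixed_point[of x i] by (rule survive_prob_ge_\<kappa>[OF limit_survival_unit_cube])
  finally show ?thesis .
qed

lemma survival_pos: "0 < survival n x $ i"
proof (induction n arbitrary: x i)
  case (Suc n)
  have "0 < \<kappa> * survival n (T x) $ i" using Suc \<kappa>_pos by simp
  also have "\<dots> \<le> survival (Suc n) x $ i"
    unfolding survival_Suc by (rule survive_prob_ge_\<kappa>[OF survival_unit_cube])
  finally show ?case .
qed simp

section \<open>Measurability\<close>

lemma survival_measurable [measurable]: "(\<lambda>x. survival n x $ i) \<in> borel_measurable borel"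
proof (induction n arbitrary: i)
  case (Suc n)
  have [measurable]: "(\<lambda>x. survival n (T x) $ j) \<in> borel_measurable borel" for j
    by (rule measurable_compose[OF T_borel Suc])
  have "(\<lambda>x. measure_pmf.expectation (\<mu> x i) (\<lambda>k. 1 - vpow (1 - survival n (T x)) k)) \<in> borel_measurable borel"
  proof (rule borel_measurable_expectation[OF law_continuous])
    show "(\<lambda>x. 1 - vpow (1 - survival n (T x)) k) \<in> borel_measurable borel" for k
      unfolding vpow_def by simp
    show "0 \<le> 1 - vpow (1 - survival n (T x)) k" for x k
      using vpow_le_1[OF one_minus_unit_cube[OF survival_unit_cube]] by simp
  qed
  then show ?case by (simp add: survival_Suc survive_prob_def)
qed simp

lemma limit_survival_measurable [measurable]: "(\<lambda>x. limit_survival x $ i) \<in> borel_measurable borel"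
  by (rule borel_measurable_LIMSEQ_real[OF survival_tendsto survival_measurable])

lemma bad_environments_measurable: "bad_environments T \<mu> \<in> sets borel"
proof -
  have "bad_environments T \<mu> = {x\<in>space borel. \<forall>i. limit_survival x $ i = 0}"
    by (auto simp: bad_iff vec_eq_iff)
  also have "\<dots> \<in> sets borel" by measurable
  finally show ?thesis .
qed

lemma mean_matrix_measurable [measurable]: "(\<lambda>x. mean_matrix \<mu> x $ i $ j) \<in> borel_measurable borel"
  unfolding mean_matrix mean_offspring_def
  by (rule borel_measurable_expectation[OF law_continuous]) auto

lemma funpow_borel [measurable]: "(T ^^ n) \<in> borel_measurable borel"
  by (induction n) (auto intro: measurable_comp)

lemma mean_cocycle_measurable [measurable]:
  "(\<lambda>x. mean_cocycle T \<mu> n x $ i $ j) \<in> borel_measurable borel"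
proof (induction n arbitrary: i j)
  case (Suc n)
  have [measurable]: "(\<lambda>x. mean_matrix \<mu> ((T ^^ n) x) $ i $ k) \<in> borel_measurable borel" for k
    by (rule measurable_compose[OF funpow_borel mean_matrix_measurable])
  note Suc [measurable]
  show ?case by (simp add: matrix_matrix_mult_def)
qed simp

section \<open>Growth of the mean matrices\<close>

lemma mean_nonneg: "0 \<le> mean_matrix \<mu> x $ i $ j"
  using C_pos mean_ge by (meson less_imp_le order_trans)

lemma mean_cocycle_nonneg: "0 \<le> mean_cocycle T \<mu> n x $ i $ j"
  by (induction n arbitrary: i j)
     (auto simp: mat_def matrix_matrix_mult_def intro!: sum_nonneg mult_nonneg_nonneg mean_nonneg)

abbreviation cocycle_norm :: "nat \<Rightarrow> 'a \<Rightarrow> real" where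
  "cocycle_norm n x \<equiv> row_sum_norm (mean_cocycle T \<mu> n x)"

lemma cocycle_norm_measurable [measurable]: "cocycle_norm n \<in> borel_measurable borel"
  unfolding row_sum_norm_def by (intro borel_measurable_Max) auto

text \<open>By induction, each row sum is at least \<open>C ^ n\<close>, as already the diagonal entries are at least \<open>C\<close>. The
rate is crude, but it suffices for \<open>ln\<close> of the norm to be bounded.\<close>

lemma cocycle_norm_ge: "C ^ n \<le> cocycle_norm n x"
proof -
  have "C ^ n \<le> (\<Sum>j\<in>UNIV. mean_cocycle T \<mu> n x $ i $ j)" for i
  proof (induction n arbitrary: i)
    case 0
    have "(\<Sum>j\<in>UNIV. (mat 1 :: real^'d^'d) $ i $ j) = (\<Sum>j\<in>UNIV. if j = i then 1 else 0)"
      by (intro sum.cong) (auto simp: mat_def)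
    then show ?case by simp
  next
    case (Suc n)
    let ?A = "mean_matrix \<mu> ((T ^^ n) x)" and ?B = "mean_cocycle T \<mu> n x"
    have "C ^ Suc n = C * C ^ n" by simp
    also have "\<dots> \<le> ?A $ i $ i * (\<Sum>j\<in>UNIV. ?B $ i $ j)"
      using C_pos by (intro mult_mono mean_ge Suc mean_nonneg) auto
    also have "\<dots> \<le> (\<Sum>k\<in>UNIV. ?A $ i $ k * (\<Sum>j\<in>UNIV. ?B $ k $ j))"
      by (rule member_le_sum) (auto intro!: mult_nonneg_nonneg sum_nonneg mean_nonneg mean_cocycle_nonneg)
    also have "\<dots> = (\<Sum>j\<in>UNIV. (?A ** ?B) $ i $ j)"
      by (simp add: matrix_matrix_mult_def sum_distrib_left) (rule sum.swap)
    finally show ?case by simp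
  qed
  also have "(\<Sum>j\<in>UNIV. mean_cocycle T \<mu> n x $ undefined $ j) \<le> cocycle_norm n x"
    using row_sum_norm_ge[of "mean_cocycle T \<mu> n x" undefined] by (simp add: mean_cocycle_nonneg)
  finally show ?thesis .
qed

lemma cocycle_norm_pos: "0 < cocycle_norm n x"
  using cocycle_norm_ge[of n x] C_pos by (meson less_le_trans zero_less_power)

lemma cocycle_norm_le: "cocycle_norm n x \<le> (real CARD('d) * D) ^ n"
proof (induction n)
  case (Suc n)
  have "row_sum_norm (mean_matrix \<mu> ((T ^^ n) x)) \<le> real CARD('d) * D"
    unfolding row_sum_norm_le_iff using mean_le mean_nonneg
    by (auto intro!: sum_bounded_above simp: abs_of_nonneg)
  then have "row_sum_norm (mean_matrix \<mu> ((T ^^ n) x)) * cocycle_norm n x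
      \<le> real CARD('d) * D * (real CARD('d) * D) ^ n"
    using Suc D_pos by (intro mult_mono row_sum_norm_nonneg) auto
  with row_sum_norm_mult[of "mean_matrix \<mu> ((T ^^ n) x)" "mean_cocycle T \<mu> n x"]
  show ?case by simp
qed simp

lemma ln_cocycle_norm_ge: "ln C * real n \<le> ln (cocycle_norm n x)"
  using ln_le_cancel_iff[of "C ^ n" "cocycle_norm n x"] cocycle_norm_ge[of n x] cocycle_norm_pos[of n x] C_pos
  by (simp add: ln_realpow mult.commute)

lemma ln_cocycle_norm_le: "ln (cocycle_norm n x) \<le> ln (real CARD('d) * D) * real n"
proof -
  have "ln (cocycle_norm n x) \<le> ln ((real CARD('d) * D) ^ n)"
    using cocycle_norm_le cocycle_norm_pos by (intro ln_mono) auto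
  also have "\<dots> = real n * ln (real CARD('d) * D)"
    by (rule ln_realpow)
  finally show ?thesis by (simp add: mult.commute)
qed

lemma ln_cocycle_norm_subadditive:
  "ln (cocycle_norm (m + n) x) \<le> ln (cocycle_norm m ((T ^^ n) x)) + ln (cocycle_norm n x)"
proof -
  have "ln (cocycle_norm (m + n) x) \<le> ln (cocycle_norm m ((T ^^ n) x) * cocycle_norm n x)"
    unfolding mean_cocycle_add
    using cocycle_norm_pos[of "m + n" x] by (intro ln_mono row_sum_norm_mult) (auto simp: mean_cocycle_add)
  also have "\<dots> = ln (cocycle_norm m ((T ^^ n) x)) + ln (cocycle_norm n x)"
    using cocycle_norm_pos[of n x] cocycle_norm_pos[of m "(T ^^ n) x"] by (intro ln_mult_pos) auto
  finally show ?thesis .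
qed

section \<open>Comparing survival with the mean matrices\<close>

text \<open>The factor by which the linearised map exceeds the nonlinear one at the survival vector, in the least
favourable type. Each quotient is \<open>0 / 0 = 0\<close> in a bad environment; since also \<open>ln 0 = 0\<close>, the
logarithms stay bounded there.\<close>

definition expansion :: "'a \<Rightarrow> real" where
  "expansion x = Min (range (\<lambda>i. (limit_survival (T x) v* mean_matrix \<mu> x) $ i / limit_survival x $ i))"

lemma expansion_le: "expansion x \<le> (limit_survival (T x) v* mean_matrix \<mu> x) $ i / limit_survival x $ i"
  unfolding expansion_def by (intro Min_le) auto

lemma expansion_bounds:
  assumes "x \<notin> bad_environments T \<mu>"
  shows "1 < expansion x" "expansion x \<le> (real CARD('d) * D / \<kappa>)"
proof -
  have "T x \<notin> bad_environments T \<mu>" using assms bad_T_iff by blast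
  then have "limit_survival x $ i < (limit_survival (T x) v* mean_matrix \<mu> x) $ i" for i
    unfolding vector_mean_matrix limit_survival_fixed_point[of x i]
    by (intro survive_prob_less_mean limit_survival_unit_cube finite_mean branching limit_survival_pos)
  then show "1 < expansion x"
    using limit_survival_pos[OF assms] by (simp add: expansion_def)
  have "(limit_survival (T x) v* mean_matrix \<mu> x) $ i / limit_survival x $ i \<le> (real CARD('d) * D / \<kappa>)" for i
    using linear_le_distortion[OF limit_survival_unit_cube, of "T x" x i] limit_survival_pos[OF assms, of i]
    by (simp add: pos_divide_le_eq flip: limit_survival_fixed_point)
  then show "expansion x \<le> (real CARD('d) * D / \<kappa>)"
    using expansion_le order_trans by blast
qed

lemma expansion_bad: "x \<in> bad_environments T \<mu> \<Longrightarrow> expansion x = 0"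
  by (simp add: expansion_def bad_iff)

lemma expansion_measurable [measurable]: "expansion \<in> borel_measurable borel"
proof -
  have [measurable]: "(\<lambda>x. limit_survival (T x) $ i) \<in> borel_measurable borel" for i
    by (rule measurable_compose[OF T_borel limit_survival_measurable])
  show ?thesis
    unfolding expansion_def vector_matrix_mult_def by (intro borel_measurable_Min) auto
qed

definition total_survival :: "'a \<Rightarrow> real" where
  "total_survival x = (\<Sum>i\<in>UNIV. limit_survival x $ i)"

lemma total_survival_measurable [measurable]: "total_survival \<in> borel_measurable borel"
  unfolding total_survival_def by measurable

lemma total_survival_pos: "x \<notin> bad_environments T \<mu> \<Longrightarrow> 0 < total_survival x"
  unfolding total_survival_def by (intro sum_pos limit_survival_pos) auto

lemma expansion_prod:
  assumes "x \<notin> bad_environments T \<mu>"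
  shows "(\<Prod>k<n. expansion ((T ^^ k) x)) * limit_survival x $ i
      \<le> (limit_survival ((T ^^ n) x) v* mean_cocycle T \<mu> n x) $ i"
proof (induction n)
  case (Suc n)
  let ?y = "(T ^^ n) x" and ?N = "mean_cocycle T \<mu> n x"
  have y: "?y \<notin> bad_environments T \<mu>" using assms by (simp add: bad_funpow_iff)
  have exp: "0 \<le> expansion ?y" using expansion_bounds[OF y] by simp
  have "(\<Prod>k<Suc n. expansion ((T ^^ k) x)) * limit_survival x $ i
      = expansion ?y * ((\<Prod>k<n. expansion ((T ^^ k) x)) * limit_survival x $ i)"
    by simp
  also have "\<dots> \<le> expansion ?y * (limit_survival ?y v* ?N) $ i"
    by (intro mult_left_mono Suc exp)
  also have "\<dots> = ((expansion ?y *\<^sub>R limit_survival ?y) v* ?N) $ i"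
    by (simp add: scaleR_vector_matrix_assoc)
  also have "\<dots> \<le> ((limit_survival (T ?y) v* mean_matrix \<mu> ?y) v* ?N) $ i"
  proof (intro vector_matrix_mono mean_cocycle_nonneg)
    fix j
    show "(expansion ?y *\<^sub>R limit_survival ?y) $ j \<le> (limit_survival (T ?y) v* mean_matrix \<mu> ?y) $ j"
      using expansion_le[of ?y j] limit_survival_pos[OF y, of j] by (simp add: pos_le_divide_eq)
  qed
  finally show ?case by (simp add: vector_matrix_mul_assoc)
qed simp

text \<open>Summing \<open>expansion_prod\<close> over the types compares total survival at both ends of the orbit with the
norm of the cocycle; the subtracted differences telescope.\<close>

lemma sum_ln_expansion_le:
  assumes "x \<notin> bad_environments T \<mu>"
  shows "(\<Sum>k<n. ln (expansion ((T ^^ k) x)) - (ln (total_survival (T ((T ^^ k) x))) - ln (total_survival ((T ^^ k) x))))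
      \<le> ln (cocycle_norm n x)"
proof -
  have good: "(T ^^ k) x \<notin> bad_environments T \<mu>" for k using assms by (simp add: bad_funpow_iff)
  have e: "0 < expansion ((T ^^ k) x)" for k using expansion_bounds[OF good[of k]] by simp
  define P where "P = (\<Prod>k<n. expansion ((T ^^ k) x))"
  have P: "0 < P" unfolding P_def using e by (intro prod_pos) auto
  have "P * total_survival x = (\<Sum>i\<in>UNIV. P * limit_survival x $ i)"
    by (simp add: total_survival_def sum_distrib_left)
  also have "\<dots> \<le> (\<Sum>i\<in>UNIV. (limit_survival ((T ^^ n) x) v* mean_cocycle T \<mu> n x) $ i)"
    unfolding P_def by (intro sum_mono expansion_prod assms)
  also have "\<dots> \<le> total_survival ((T ^^ n) x) * cocycle_norm n x"
    unfolding total_survival_def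
    by (intro sum_vector_matrix_le unit_cubeD limit_survival_unit_cube mean_cocycle_nonneg)
  finally have "ln (P * total_survival x) \<le> ln (total_survival ((T ^^ n) x) * cocycle_norm n x)"
    using P total_survival_pos[OF assms] by (intro ln_mono) auto
  then have "ln P + ln (total_survival x) \<le> ln (total_survival ((T ^^ n) x)) + ln (cocycle_norm n x)"
    using P total_survival_pos[OF assms] total_survival_pos[OF good[of n]] cocycle_norm_pos[of n x]
    by (simp add: ln_mult)
  moreover have "ln P = (\<Sum>k<n. ln (expansion ((T ^^ k) x)))"
    unfolding P_def by (intro ln_prod finite_lessThan less_imp_neq[symmetric] e)
  moreover have "(\<Sum>k<n. ln (total_survival (T ((T ^^ k) x))) - ln (total_survival ((T ^^ k) x)))
      = ln (total_survival ((T ^^ n) x)) - ln (total_survival x)"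
    using sum_lessThan_telescope[of "\<lambda>k. ln (total_survival ((T ^^ k) x))" n] by simp
  ultimately show ?thesis by (simp add: sum_subtractf)
qed

text \<open>The total survival probability may be arbitrarily small, but its quotients along the orbit are
bounded above and below by the uniform bounds on means and on offspring probabilities.\<close>

lemma total_survival_cohomology_bound:
  "\<bar>ln (total_survival (T x)) - ln (total_survival x)\<bar> \<le> \<bar>ln \<kappa>\<bar> + \<bar>ln (real CARD('d) * D)\<bar>"
proof (cases "x \<in> bad_environments T \<mu>")
  case True
  then have "T x \<in> bad_environments T \<mu>" by (simp add: bad_T_iff)
  with True show ?thesis by (simp add: bad_iff total_survival_def)
next
  case False
  then have "T x \<notin> bad_environments T \<mu>" by (simp add: bad_T_iff)
  note pos = total_survival_pos[OF False] total_survival_pos[OF this]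
  have "\<kappa> * total_survival (T x) = (\<Sum>i\<in>UNIV. \<kappa> * limit_survival (T x) $ i)"
    by (simp add: total_survival_def sum_distrib_left)
  also have "\<dots> \<le> total_survival x"
    unfolding total_survival_def limit_survival_fixed_point[of x]
    by (intro sum_mono survive_prob_ge_\<kappa> limit_survival_unit_cube)
  finally have "ln (\<kappa> * total_survival (T x)) \<le> ln (total_survival x)"
    using pos \<kappa>_pos by (intro ln_mono) auto
  then have 1: "ln \<kappa> + ln (total_survival (T x)) \<le> ln (total_survival x)"
    using pos \<kappa>_pos by (simp add: ln_mult)
  have "total_survival x \<le> (\<Sum>i\<in>(UNIV :: 'd set). D * total_survival (T x))"
    unfolding total_survival_def[of x] limit_survival_fixed_point[of x] total_survival_def[of "T x"]
    by (intro sum_mono order_trans[OF survive_prob_le_linear linear_le] limit_survival_unit_cube)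
  then have "total_survival x \<le> real CARD('d) * D * total_survival (T x)" by simp
  then have "ln (total_survival x) \<le> ln (real CARD('d) * D * total_survival (T x))"
    using pos by (intro ln_mono) auto
  also have "\<dots> = ln (real CARD('d) * D) + ln (total_survival (T x))"
    using pos D_pos by (intro ln_mult_pos) auto
  finally show ?thesis using 1 by linarith
qed

text \<open>The price of replacing the linearised map by the nonlinear one, in front of \<open>m\<close> further generations.
Every factor is at least \<open>1\<close>, so that the product bounds each single factor, as the maximum
would, and has an additive logarithm.\<close>

definition loss :: "nat \<Rightarrow> 'a \<Rightarrow> real" where
  "loss m x = (\<Prod>i\<in>UNIV. (survival m (T x) v* mean_matrix \<mu> x) $ i / survival (Suc m) x $ i)"

lemma loss_factor_bounds:
  shows "1 \<le> (survival m (T x) v* mean_matrix \<mu> x) $ i / survival (Suc m) x $ i"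
    and "(survival m (T x) v* mean_matrix \<mu> x) $ i / survival (Suc m) x $ i \<le> (real CARD('d) * D / \<kappa>)"
  using survive_prob_le_linear[OF survival_unit_cube, of x i m "T x"]
    linear_le_distortion[OF survival_unit_cube, of m "T x" x i] survival_pos[of "Suc m" x i]
  by (simp_all add: pos_le_divide_eq pos_divide_le_eq flip: survival_Suc)

lemma loss_bounds: "1 \<le> loss m x" "loss m x \<le> (real CARD('d) * D / \<kappa>) ^ CARD('d)"
proof -
  show "1 \<le> loss m x" unfolding loss_def by (intro prod_ge_1 loss_factor_bounds)
  have "loss m x \<le> (\<Prod>i\<in>(UNIV :: 'd set). (real CARD('d) * D / \<kappa>))"
    unfolding loss_def by (intro prod_mono conjI loss_factor_bounds order_trans[OF _ loss_factor_bounds(1)]) auto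
  then show "loss m x \<le> (real CARD('d) * D / \<kappa>) ^ CARD('d)" by simp
qed

lemma linear_le_loss: "(survival m (T x) v* mean_matrix \<mu> x) $ i \<le> loss m x * survival (Suc m) x $ i"
proof -
  let ?r = "\<lambda>i. (survival m (T x) v* mean_matrix \<mu> x) $ i / survival (Suc m) x $ i"
  have "?r i * 1 \<le> ?r i * (\<Prod>j\<in>UNIV - {i}. ?r j)"
    by (intro mult_left_mono prod_ge_1 loss_factor_bounds(1) order_trans[OF zero_le_one loss_factor_bounds(1)])
  also have "\<dots> = loss m x" unfolding loss_def by (subst (2) prod.remove[of _ i]) auto
  finally show ?thesis using survival_pos[of "Suc m" x i] by (simp add: pos_divide_le_eq)
qed

lemma loss_measurable [measurable]: "loss m \<in> borel_measurable borel"
proof -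
  have [measurable]: "(\<lambda>x. survival m (T x) $ i) \<in> borel_measurable borel" for i
    by (rule measurable_compose[OF T_borel survival_measurable])
  show ?thesis
    unfolding loss_def vector_matrix_mult_def by simp
qed

lemma loss_tendsto_1:
  assumes "x \<in> bad_environments T \<mu>"
  shows "(\<lambda>m. loss m x) \<longlonglongrightarrow> 1"
proof -
  have "limit_survival (T x) = 0" using assms by (simp add: bad_T_iff flip: bad_iff)
  then have lim: "(\<lambda>m. survival m (T x) $ j) \<longlonglongrightarrow> 0" for j
    using survival_tendsto[of "T x" j] by simp
  have "(\<lambda>m. (survival m (T x) v* mean_matrix \<mu> x) $ i / survival (Suc m) x $ i) \<longlonglongrightarrow> 1" for i
  proof -
    have "0 < mean_offspring (\<mu> x i) j" for j
      using mean_ge[of x j i] C_pos by (simp add: mean_matrix)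
    from survive_prob_asymp[OF survival_unit_cube survival_pos lim finite_mean this]
    have "(\<lambda>m. survival (Suc m) x $ i / (survival m (T x) v* mean_matrix \<mu> x) $ i) \<longlonglongrightarrow> 1"
      by (simp add: survival_Suc vector_mean_matrix)
    from tendsto_inverse[OF this] show ?thesis by simp
  qed
  then show ?thesis
    unfolding loss_def using tendsto_prod[of UNIV _ "\<lambda>_. 1"] by fastforce
qed

text \<open>In the step the last matrix of the product is the one that acts first on the row vector, so it is
replaced first and the number \<open>m\<close> of remaining generations grows; the induction hypothesis is needed for
all \<open>m\<close>.\<close>

lemma loss_prod:
  "(survival m ((T ^^ n) x) v* mean_cocycle T \<mu> n x) $ i
    \<le> (\<Prod>k<n. loss (m + n - Suc k) ((T ^^ k) x)) * survival (m + n) x $ i"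
proof (induction n arbitrary: m)
  case (Suc n)
  let ?y = "(T ^^ n) x" and ?N = "mean_cocycle T \<mu> n x"
  have "(survival m ((T ^^ Suc n) x) v* mean_cocycle T \<mu> (Suc n) x) $ i
      = ((survival m (T ?y) v* mean_matrix \<mu> ?y) v* ?N) $ i"
    by (simp add: vector_matrix_mul_assoc)
  also have "\<dots> \<le> ((loss m ?y *\<^sub>R survival (Suc m) ?y) v* ?N) $ i"
    by (intro vector_matrix_mono mean_cocycle_nonneg) (simp add: linear_le_loss)
  also have "\<dots> = loss m ?y * (survival (Suc m) ?y v* ?N) $ i"
    by (simp add: scaleR_vector_matrix_assoc)
  also have "\<dots> \<le> loss m ?y * ((\<Prod>k<n. loss (Suc m + n - Suc k) ((T ^^ k) x)) * survival (Suc m + n) x $ i)"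
    using loss_bounds(1)[of m ?y] by (intro mult_left_mono Suc) auto
  also have "\<dots> = (\<Prod>k<Suc n. loss (m + Suc n - Suc k) ((T ^^ k) x)) * survival (m + Suc n) x $ i"
    by simp
  finally show ?case .
qed simp

lemma ln_cocycle_norm_le_sum_loss:
  "ln (cocycle_norm n x) \<le> ln (real CARD('d)) + (\<Sum>k<n. ln (loss (n - Suc k) ((T ^^ k) x)))"
proof -
  define P where "P = (\<Prod>k<n. loss (n - Suc k) ((T ^^ k) x))"
  have l: "0 < loss m y" for m y using loss_bounds(1)[of m y] by simp
  have P: "0 < P" unfolding P_def using l by (intro prod_pos) auto
  have "cocycle_norm n x \<le> (\<Sum>j\<in>UNIV. (1 v* mean_cocycle T \<mu> n x) $ j)"
    by (intro row_sum_norm_le_sum_vector_matrix mean_cocycle_nonneg)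
  also have "\<dots> \<le> (\<Sum>j\<in>(UNIV :: 'd set). P * 1)"
  proof (rule sum_mono)
    fix j
    have "(1 v* mean_cocycle T \<mu> n x) $ j \<le> P * survival n x $ j"
      using loss_prod[of 0 n x j] by (simp add: P_def)
    also have "\<dots> \<le> P * 1"
      using P by (intro mult_left_mono unit_cubeD survival_unit_cube) auto
    finally show "(1 v* mean_cocycle T \<mu> n x) $ j \<le> P * 1" .
  qed
  finally have "ln (cocycle_norm n x) \<le> ln (real CARD('d) * P)"
    using cocycle_norm_pos[of n x] by (intro ln_mono) auto
  also have "\<dots> = ln (real CARD('d)) + ln P" using P by (intro ln_mult_pos) auto
  also have "ln P = (\<Sum>k<n. ln (loss (n - Suc k) ((T ^^ k) x)))"
    unfolding P_def by (intro ln_prod finite_lessThan less_imp_neq[symmetric] l)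
  finally show ?thesis .
qed

end

section \<open>Integrating over the environment\<close>

locale invariant_branching_environment =
  branching_environment T \<mu> C D \<kappa> + invariant_measure \<nu> T
  for T :: "'a::metric_space \<Rightarrow> 'a" and \<mu> :: "'a \<Rightarrow> 'd::finite \<Rightarrow> (nat^'d) pmf"
    and C D \<kappa> :: real and \<nu> :: "'a measure" +
  assumes sets_\<nu> [measurable_cong]: "sets \<nu> = sets borel"
begin

lemma borel_imp_\<nu>: "f \<in> borel_measurable borel \<Longrightarrow> f \<in> borel_measurable \<nu>"
  using measurable_cong_sets[OF sets_\<nu> refl] by blast

definition mean_log :: "nat \<Rightarrow> real" where
  "mean_log n = (\<integral>x. ln (cocycle_norm n x) \<partial>\<nu>)"

lemma integrable_ln_cocycle_norm: "integrable \<nu> (\<lambda>x. ln (cocycle_norm n x))"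
proof (rule integrable_const_bound[where B = "max \<bar>ln C * real n\<bar> \<bar>ln (real CARD('d) * D) * real n\<bar>"])
  show "AE x in \<nu>. norm (ln (cocycle_norm n x)) \<le> max \<bar>ln C * real n\<bar> \<bar>ln (real CARD('d) * D) * real n\<bar>"
    using ln_cocycle_norm_ge[of n] ln_cocycle_norm_le[of n] by (intro AE_I2) (simp add: abs_le_iff, smt)
  show "(\<lambda>x. ln (cocycle_norm n x)) \<in> borel_measurable \<nu>"
    by (rule borel_imp_\<nu>) measurable
qed

text \<open>The norm is submultiplicative and the measure invariant, so the integrals are subadditive.\<close>

lemma growth_rate_limit: "(\<lambda>n. 1 / real n * mean_log n) \<longlonglongrightarrow> growth_rate T \<mu> \<nu>"
proof -
  have "convergent (\<lambda>n. 1 / real n * mean_log n)"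
  proof (rule fekete_real)
    fix m n
    have int: "integrable \<nu> (\<lambda>x. ln (cocycle_norm m ((T ^^ n) x)))"
      using integrable_distr[OF funpow_measurable[of n], of "\<lambda>x. ln (cocycle_norm m x)"] integrable_ln_cocycle_norm[of m]
      by (simp add: distr_funpow)
    have "mean_log (m + n) \<le> (\<integral>x. ln (cocycle_norm m ((T ^^ n) x)) + ln (cocycle_norm n x) \<partial>\<nu>)"
      unfolding mean_log_def
      by (intro integral_mono integrable_ln_cocycle_norm Bochner_Integration.integrable_add int ln_cocycle_norm_subadditive)
    also have "\<dots> = (\<integral>x. ln (cocycle_norm m ((T ^^ n) x)) \<partial>\<nu>) + mean_log n"
      using int integrable_ln_cocycle_norm[of n] by (simp add: mean_log_def)
    also have "(\<integral>x. ln (cocycle_norm m ((T ^^ n) x)) \<partial>\<nu>) = mean_log m"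
      unfolding mean_log_def by (rule integral_funpow) (rule borel_measurable_integrable[OF integrable_ln_cocycle_norm])
    finally show "mean_log (m + n) \<le> mean_log m + mean_log n" .
  next
    fix n
    show "ln C * real n \<le> mean_log n"
      unfolding mean_log_def by (intro integral_ge_const integrable_ln_cocycle_norm AE_I2 ln_cocycle_norm_ge)
  qed
  then show ?thesis
    unfolding growth_rate_def mean_log_def by (simp only: convergent_LIMSEQ_iff)
qed

text \<open>The mean of \<open>ln expansion\<close> is a lower bound for the growth rate, as the coboundary in
\<open>sum_ln_expansion_le\<close> integrates to \<open>0\<close>, and it is positive because the expansion exceeds \<open>1\<close>
almost everywhere.\<close>

lemma growth_rate_pos_if_survival:
  assumes "AE x in \<nu>. x \<notin> bad_environments T \<mu>"
  shows "0 < growth_rate T \<mu> \<nu>"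
proof -
  define g where "g x = ln (total_survival x)" for x
  define e where "e x = ln (expansion x)" for x
  define h where "h x = e x - (g (T x) - g x)" for x
  have [measurable]: "g \<in> borel_measurable \<nu>" "e \<in> borel_measurable \<nu>"
    unfolding g_def e_def by (auto intro!: borel_imp_\<nu>)
  have [measurable]: "h \<in> borel_measurable \<nu>" unfolding h_def by measurable
  have g: "\<bar>g (T x) - g x\<bar> \<le> \<bar>ln \<kappa>\<bar> + \<bar>ln (real CARD('d) * D)\<bar>" for x
    unfolding g_def by (rule total_survival_cohomology_bound)
  have e: "\<bar>e x\<bar> \<le> \<bar>ln (real CARD('d) * D / \<kappa>)\<bar>" "0 \<le> e x" for x
  proof (atomize (full), cases "x \<in> bad_environments T \<mu>")
    case False
    then show "\<bar>e x\<bar> \<le> \<bar>ln (real CARD('d) * D / \<kappa>)\<bar> \<and> 0 \<le> e x"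
      using expansion_bounds[OF False] ln_mono[of "expansion x" "real CARD('d) * D / \<kappa>"] by (simp add: e_def)
  qed (simp add: e_def expansion_bad)
  have int_e: "integrable \<nu> e"
    using e by (intro integrable_const_bound[where B = "\<bar>ln (real CARD('d) * D / \<kappa>)\<bar>"]) auto
  have int_g: "integrable \<nu> (\<lambda>x. g (T x) - g x)"
    using g by (intro integrable_const_bound[where B = "\<bar>ln \<kappa>\<bar> + \<bar>ln (real CARD('d) * D)\<bar>"]) auto
  have int_h: "integrable \<nu> h" unfolding h_def using int_e int_g by simp
  have "integral\<^sup>L \<nu> h = integral\<^sup>L \<nu> e - (\<integral>x. g (T x) - g x \<partial>\<nu>)"
    unfolding h_def by (rule Bochner_Integration.integral_diff[OF int_e int_g])
  also have "(\<integral>x. g (T x) - g x \<partial>\<nu>) = 0"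
    by (rule integral_coboundary[OF \<open>g \<in> borel_measurable \<nu>\<close> g])
  finally have h_e: "integral\<^sup>L \<nu> h = integral\<^sup>L \<nu> e" by simp
  have "AE x in \<nu>. e x \<noteq> 0"
    using assms
  proof eventually_elim
    case (elim x)
    show ?case using expansion_bounds(1)[OF elim] by (simp add: e_def)
  qed
  have "\<not> (AE x in \<nu>. e x = 0)"
  proof
    assume "AE x in \<nu>. e x = 0"
    with \<open>AE x in \<nu>. e x \<noteq> 0\<close> have "AE x in \<nu>. False" by eventually_elim simp
    then show False by simp
  qed
  then have "integral\<^sup>L \<nu> e \<noteq> 0"
    using integral_nonneg_eq_0_iff_AE[OF int_e] e(2) by simp
  moreover have "0 \<le> integral\<^sup>L \<nu> e" using e(2) by simp
  ultimately have pos: "0 < integral\<^sup>L \<nu> e" by simp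
  have "integral\<^sup>L \<nu> e \<le> 1 / real n * mean_log n" if n: "1 \<le> n" for n
  proof -
    have int: "integrable \<nu> (\<lambda>x. h ((T ^^ k) x))" for k
      using integrable_distr[OF funpow_measurable[of k], of h] int_h by (simp add: distr_funpow)
    have "real n * integral\<^sup>L \<nu> e = (\<Sum>k<n. \<integral>x. h ((T ^^ k) x) \<partial>\<nu>)"
      by (simp add: integral_funpow h_e)
    also have "\<dots> = (\<integral>x. (\<Sum>k<n. h ((T ^^ k) x)) \<partial>\<nu>)"
      by (rule Bochner_Integration.integral_sum[symmetric]) (rule int)
    also have "\<dots> \<le> mean_log n"
      unfolding mean_log_def
    proof (intro integral_mono_AE Bochner_Integration.integrable_sum int integrable_ln_cocycle_norm)
      show "AE x in \<nu>. (\<Sum>k<n. h ((T ^^ k) x)) \<le> ln (cocycle_norm n x)"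
        using assms unfolding h_def e_def g_def by eventually_elim (rule sum_ln_expansion_le)
    qed
    finally show ?thesis using n by (simp add: field_simps)
  qed
  then have "integral\<^sup>L \<nu> e \<le> growth_rate T \<mu> \<nu>"
    by (intro LIMSEQ_le_const[OF growth_rate_limit]) blast
  with pos show ?thesis by simp
qed

text \<open>By invariance the orbit points in \<open>ln_cocycle_norm_le_sum_loss\<close> disappear after integration, which
leaves the means of \<open>ln loss\<close>. These tend to \<open>0\<close> by dominated convergence, hence so do their averages.\<close>

lemma growth_rate_nonpos_if_extinction:
  assumes "AE x in \<nu>. x \<in> bad_environments T \<mu>"
  shows "growth_rate T \<mu> \<nu> \<le> 0"
proof -
  define l where "l m = (\<integral>x. ln (loss m x) \<partial>\<nu>)" for m
  define B where "B = ln ((real CARD('d) * D / \<kappa>) ^ CARD('d))"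
  have [measurable]: "(\<lambda>x. ln (loss m x)) \<in> borel_measurable \<nu>" for m
    by (rule borel_imp_\<nu>) measurable
  have bound: "\<bar>ln (loss m x)\<bar> \<le> B" for m x
    unfolding B_def using loss_bounds[of m x] ln_mono[of "loss m x" "(real CARD('d) * D / \<kappa>) ^ CARD('d)"] by simp
  have int: "integrable \<nu> (\<lambda>x. ln (loss m x))" for m
    using bound by (intro integrable_const_bound[where B = B]) auto
  have intT: "integrable \<nu> (\<lambda>x. ln (loss m ((T ^^ k) x)))" for m k
    using integrable_distr[OF funpow_measurable[of k], of "\<lambda>x. ln (loss m x)"] int by (simp add: distr_funpow)
  have "l \<longlonglongrightarrow> (\<integral>x. 0 \<partial>\<nu>)"
    unfolding l_def
  proof (rule integral_dominated_convergence[where w = "\<lambda>_. B"])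
    show "AE x in \<nu>. (\<lambda>m. ln (loss m x)) \<longlonglongrightarrow> 0"
      using assms
    proof eventually_elim
      case (elim x)
      from tendsto_ln[OF loss_tendsto_1[OF elim]] show ?case by simp
    qed
  qed (use bound in auto)
  then have l: "l \<longlonglongrightarrow> 0" by simp
  have upper: "1 / real n * mean_log n \<le> ln (real CARD('d)) / real n + 1 / real n * (\<Sum>k<n. l k)" for n
  proof -
    have "mean_log n \<le> (\<integral>x. ln (real CARD('d)) + (\<Sum>k<n. ln (loss (n - Suc k) ((T ^^ k) x))) \<partial>\<nu>)"
      unfolding mean_log_def
      by (intro integral_mono integrable_ln_cocycle_norm ln_cocycle_norm_le_sum_loss
            Bochner_Integration.integrable_add Bochner_Integration.integrable_sum intT integrable_const)
    also have "\<dots> = ln (real CARD('d)) + (\<Sum>k<n. \<integral>x. ln (loss (n - Suc k) ((T ^^ k) x)) \<partial>\<nu>)"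
      using intT by (simp add: Bochner_Integration.integral_add Bochner_Integration.integral_sum prob_space)
    also have "(\<Sum>k<n. \<integral>x. ln (loss (n - Suc k) ((T ^^ k) x)) \<partial>\<nu>) = (\<Sum>k<n. l (n - Suc k))"
      unfolding l_def by (intro sum.cong refl integral_funpow) measurable
    also have "\<dots> = (\<Sum>k<n. l k)" by (rule sum.nat_diff_reindex)
    finally have "1 / real n * mean_log n \<le> 1 / real n * (ln (real CARD('d)) + (\<Sum>k<n. l k))"
      by (intro mult_left_mono) auto
    then show ?thesis by (simp add: distrib_left)
  qed
  have "(\<lambda>n. ln (real CARD('d)) / real n + 1 / real n * (\<Sum>k<n. l k)) \<longlonglongrightarrow> 0 + 0"
    by (intro tendsto_add lim_const_over_n cesaro_null l)
  then show ?thesis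
    using LIMSEQ_le[OF growth_rate_limit] upper by auto
qed

end

section \<open>The extinction criterion\<close>

text \<open>The probability of having a child of type \<open>j\<close> is a continuous function of the environment and never
\<open>0\<close>, because the mean number of such children is positive; compactness makes it uniform.\<close>

lemma offspring_probability_lower_bound:
  fixes \<mu> :: "'a::metric_space \<Rightarrow> 'd::finite \<Rightarrow> (nat^'d) pmf"
  assumes compact: "compact (UNIV :: 'a set)"
    and cont: "continuous_map euclidean (product_topology (\<lambda>_. weak_topology) UNIV) \<mu>"
    and pos: "\<And>x i j. 0 < mean_offspring (\<mu> x i) j"
  obtains \<kappa> where "0 < \<kappa>" "\<And>x i j. \<kappa> \<le> measure_pmf.prob (\<mu> x i) {k. k $ j \<noteq> 0}"
proof -
  define P where "P i j x = measure_pmf.prob (\<mu> x i) {k. k $ j \<noteq> 0}" for i j x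
  have pos: "0 < P i j x" for i j x
  proof (rule ccontr)
    assume "\<not> 0 < P i j x"
    then have "measure_pmf.prob (\<mu> x i) {k. k $ j \<noteq> 0} = 0"
      unfolding P_def using measure_nonneg[of "measure_pmf (\<mu> x i)"] by (simp add: not_less order_antisym)
    then have "set_pmf (\<mu> x i) \<inter> {k. k $ j \<noteq> 0} = {}" by (simp add: measure_pmf_zero_iff)
    then have "AE k in measure_pmf (\<mu> x i). real (k $ j) = 0" by (auto simp: AE_measure_pmf_iff)
    then have "mean_offspring (\<mu> x i) j = 0"
      unfolding mean_offspring_def by (rule integral_eq_zero_AE)
    with pos[of x i j] show False by simp
  qed
  have "\<exists>c>0. \<forall>x. c \<le> P i j x" for i j
  proof -
    have "bounded (range (indicator {k. k $ j \<noteq> 0} :: nat^'d \<Rightarrow> real))"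
      by (intro boundedI[where B = 1]) auto
    from continuous_expectation[OF cont this] have "continuous_on UNIV (P i j)"
      by (simp add: P_def)
    from continuous_attains_inf[OF compact _ this] show ?thesis using pos by auto
  qed
  then obtain c where c: "\<And>i j. 0 < c i j" "\<And>i j x. c i j \<le> P i j x" by metis
  show thesis
  proof (rule that[of "Min (range (\<lambda>(i, j). c i j))"])
    show "0 < Min (range (\<lambda>(i, j). c i j))" using c(1) by auto
    fix x i j
    have "Min (range (\<lambda>(i, j). c i j)) \<le> c i j" by (intro Min_le) auto
    also have "\<dots> \<le> P i j x" by (rule c)
    finally show "Min (range (\<lambda>(i, j). c i j)) \<le> measure_pmf.prob (\<mu> x i) {k. k $ j \<noteq> 0}"
      by (simp add: P_def)
  qed
qed

theorem theorem3p2: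
  fixes T :: "'a::metric_space \<Rightarrow> 'a"
    and \<mu> :: "'a \<Rightarrow> 'd::finite \<Rightarrow> (nat^'d) pmf"
    and \<nu> :: "'a measure"
    and C D :: real
  assumes "compact (UNIV :: 'a set)"
    and "continuous_on UNIV T"
    and "continuous_map euclidean (product_topology (\<lambda>_. weak_topology) UNIV) \<mu>"
    and "\<And>x i. 0 \<le> pmf (\<mu> x i) 0 + (\<Sum>j\<in>UNIV. pmf (\<mu> x i) (axis j 1)) \<and>
               pmf (\<mu> x i) 0 + (\<Sum>j\<in>UNIV. pmf (\<mu> x i) (axis j 1)) < 1"
    and "0 < C" and "C \<le> D"
    and "\<And>x i j. has_left_partial i (gen_fun \<mu> j x) 1"
    and "\<And>x i j. C \<le> mean_matrix \<mu> x $ i $ j \<and> mean_matrix \<mu> x $ i $ j \<le> D"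
    and "\<And>x i j k. has_left_partial i (left_partial j (gen_fun \<mu> k x)) 1"
    and "\<And>x i j k. left_partial i (left_partial j (gen_fun \<mu> k x)) 1 \<le> D"
    and "invariant_ergodic T \<nu>"
  shows "emeasure \<nu> (bad_environments T \<mu>) = 0 \<longleftrightarrow> growth_rate T \<mu> \<nu> > 0"
proof -
  have mean: "mean_matrix \<mu> x $ j $ i = mean_offspring (\<mu> x i) j" for x i j
    by (rule mean_matrix_eq[OF assms(7)])
  have pos: "0 < mean_offspring (\<mu> x i) j" for x i j
    using assms(5,8) by (metis less_le_trans mean)
  obtain \<kappa> where \<kappa>: "0 < \<kappa>" "\<And>x i j. \<kappa> \<le> measure_pmf.prob (\<mu> x i) {k. k $ j \<noteq> 0}"
    using offspring_probability_lower_bound[OF assms(1,3) pos] by blast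
  have \<nu>: "prob_space \<nu>" "sets \<nu> = sets borel" "T \<in> measurable \<nu> \<nu>" "distr \<nu> \<nu> T = \<nu>"
    "\<And>A. A \<in> sets \<nu> \<Longrightarrow> T -` A = A \<Longrightarrow> measure \<nu> A = 0 \<or> measure \<nu> A = 1"
    using assms(11) by (auto simp: invariant_ergodic_def)
  interpret prob_space \<nu> by (rule \<nu>)
  interpret invariant_branching_environment T \<mu> C D \<kappa> \<nu>
  proof
    show "T \<in> borel_measurable borel"
      by (rule borel_measurable_continuous_onI[OF assms(2)])
    show "finite_mean (\<mu> x i)" for x i
      unfolding finite_mean_def using integrable_from_left_partial[OF assms(7)] by blast
  qed (use assms mean \<kappa> \<nu> in auto)
  let ?N = "bad_environments T \<mu>"
  have N: "?N \<in> sets \<nu>" using bad_environments_measurable \<nu>(2) by simp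
  show ?thesis
  proof
    assume "emeasure \<nu> ?N = 0"
    then have "AE x in \<nu>. x \<notin> ?N" using N by (intro AE_not_in) (auto simp: null_sets_def)
    then show "growth_rate T \<mu> \<nu> > 0" by (rule growth_rate_pos_if_survival)
  next
    assume growth: "growth_rate T \<mu> \<nu> > 0"
    have "T -` ?N = ?N" using bad_T_iff by auto
    with \<nu>(5)[OF N] consider "measure \<nu> ?N = 0" | "measure \<nu> ?N = 1" by blast
    then show "emeasure \<nu> ?N = 0"
    proof cases
      case 1
      then show ?thesis by (simp add: emeasure_eq_measure)
    next
      case 2
      then have "AE x in \<nu>. x \<in> ?N" using N by (simp add: prob_eq_1)
      then have "growth_rate T \<mu> \<nu> \<le> 0" by (rule growth_rate_nonpos_if_extinction)
      with growth show ?thesis by simp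
    qed
  qed
qed

end
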